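(* There exist a probability density function $f$ on $\mathbb{T}$ with $m_f>0$ and $\dim_{\mathrm H}K_f<\overline{\dim}_{\mathrm B}K_f=1$, and a decreasing (i.e. non-increasing) sequence $\{\ell_n\}_{n\in\mathbb{N}}$ with $0<\ell_n<1$ satisfying $$\limsup_{n\to\infty}\left(\frac{\ell_1+\dots+\ell_n}{\ln n}\right)\ \ge\ \frac{1}{m_f},$$ such that $\mathbb{T}$ is not $\mu_f$-Dvoretzky covered for $\{\ell_n\}$.
   Context: $\mathbb{T}=\mathbb{R}/\mathbb{Z}$ is the circle with its usual metric and Lebesgue measure $|\cdot|$ (total mass $1$). A probability density function is a nonnegative $f\in L^1(\mathbb{T})$ with $\int_{\mathbb{T}}f=1$, and $\mu_f$ is the probability measure with $d\mu_f=f\,dx$. Given $\{\ell_n\}$, let $\{\omega_n\}$ be i.i.d. random variables on $\mathbb{T}$ with distribution $\mu_f$ and $I_n=(\omega_n-\ell_n/2,\ \omega_n+\ell_n/2)\subset\mathbb{T}$. The circle is $\mu_f$-Dvoretzky covered for $\{\ell_n\}$ if almost surely $\mathbb{T}=\limsup_{n\to\infty}I_n$, i.e. almost surely every point of $\mathbb{T}$ lies in infinitely many $I_n$. For a measurable set $J\subset\mathbb{T}$ with $|J|>0$, $\mathrm{ess\,inf}_J f=\sup\{a\in\mathbb{R}: f(x)\ge a \text{ for Lebesgue a.e. } x\in J\}$. Put $m_f=\mathrm{ess\,inf}_{\mathbb{T}}f$ and $K_f=\{x\in\mathbb{T}:\lim_{n\to\infty}\mathrm{ess\,inf}_{B(x,1/n)}f=m_f\}$,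 where $B(x,r)$ is the ball of radius $r$ centered at $x$. $\dim_{\mathrm H}$ is Hausdorff dimension and $\overline{\dim}_{\mathrm B}$ is the upper box-counting dimension: $\overline{\dim}_{\mathrm B}Z=\limsup_{\delta\to0}\frac{\ln M(Z,\delta)}{-\ln\delta}$, with $M(Z,\delta)$ the least number of $\delta$-balls needed to cover $Z$. *)

theory Defs
  imports "HOL-Probability.Probability"
begin

section \<open>The circle\<close>

quotient_type circle = real / "\<lambda>x y :: real. x - y \<in> \<int>"
  morphisms rep_circle to_circle
proof (rule equivpI)
  show "reflp (\<lambda>x y :: real. x - y \<in> \<int>)"
    by (simp add: reflp_def)
  show "symp (\<lambda>x y :: real. x - y \<in> \<int>)"
    by (metis (no_types, lifting) Ints_minus minus_diff_eq sympI)
  show "transp (\<lambda>x y :: real. x - y \<in> \<int>)"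
  proof (rule transpI)
    fix x y z :: real
    assume "x - y \<in> \<int>" "y - z \<in> \<int>"
    then have "(x - y) + (y - z) \<in> \<int>" by (rule Ints_add)
    then show "x - z \<in> \<int>" by simp
  qed
qed

lemma infdist_Ints_attained:
  fixes x :: real
  obtains k where "k \<in> \<int>" "infdist x \<int> = \<bar>x - k\<bar>"
  using infdist_attains_inf[of "\<int> :: real set" x] closed_Ints Ints_0
  by (metis dist_real_def empty_iff)

lemma infdist_Ints_le:
  fixes x k :: real
  assumes "k \<in> \<int>" shows "infdist x \<int> \<le> \<bar>x - k\<bar>"
  using infdist_le[OF assms, of x] by (simp add: dist_real_def)

lemma infdist_Ints_add_le:
  fixes x y :: real
  shows "infdist (x + y) \<int> \<le> infdist x \<int> + infdist y \<int>"
proof -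
  obtain k where k: "k \<in> \<int>" "infdist x \<int> = \<bar>x - k\<bar>" by (rule infdist_Ints_attained)
  obtain l where l: "l \<in> \<int>" "infdist y \<int> = \<bar>y - l\<bar>" by (rule infdist_Ints_attained)
  have "infdist (x + y) \<int> \<le> \<bar>x + y - (k + l)\<bar>"
    using k(1) l(1) by (intro infdist_Ints_le Ints_add)
  also have "\<dots> \<le> \<bar>x - k\<bar> + \<bar>y - l\<bar>" by linarith
  finally show ?thesis using k l by simp
qed

lemma infdist_Ints_of_Ints:
  fixes k :: real
  assumes "k \<in> \<int>" shows "infdist k \<int> = 0"
  using assms by (rule infdist_zero)

lemma infdist_Ints_minus:
  fixes x :: real
  shows "infdist (- x) \<int> = infdist x \<int>"
proof -
  have le: "infdist (- y) \<int> \<le> infdist y \<int>" for y :: real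
  proof -
    obtain k where k: "k \<in> \<int>" "infdist y \<int> = \<bar>y - k\<bar>" by (rule infdist_Ints_attained)
    have "infdist (- y) \<int> \<le> \<bar>- y - (- k)\<bar>" using k(1) by (intro infdist_Ints_le Ints_minus)
    then show ?thesis using k(2) by simp
  qed
  show ?thesis using le[of x] le[of "- x"] by simp
qed

instantiation circle :: metric_space
begin

lift_definition dist_circle :: "circle \<Rightarrow> circle \<Rightarrow> real" is "\<lambda>x y. infdist (x - y) \<int>"
proof -
  fix x x' y y' :: real
  assume k: "x - x' \<in> \<int>" and l: "y - y' \<in> \<int>"
  have le: "infdist (u + m) \<int> \<le> infdist u \<int>" if "m \<in> \<int>" for u m :: real
    using infdist_Ints_add_le[of u m] infdist_Ints_of_Ints[OF that] by simp
  define m where "m = (x - x') - (y - y')"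
  have m: "m \<in> \<int>" "- m \<in> \<int>" using k l by (auto simp: m_def simp del: minus_diff_eq)
  have "x - y = (x' - y') + m" "x' - y' = (x - y) + - m" by (auto simp: m_def)
  then show "infdist (x - y) \<int> = infdist (x' - y') \<int>"
    using le[OF m(1), of "x' - y'"] le[OF m(2), of "x - y"] by simp
qed

definition uniformity_circle :: "(circle \<times> circle) filter" where
  "uniformity_circle = (INF e\<in>{0<..}. principal {(x, y). dist x y < e})"

definition open_circle :: "circle set \<Rightarrow> bool" where
  "open_circle U \<longleftrightarrow> (\<forall>x\<in>U. \<forall>\<^sub>F (x', y) in uniformity. x' = x \<longrightarrow> y \<in> U)"

instance
proof
  show "(uniformity :: (circle \<times> circle) filter)
      = (INF e\<in>{0<..}. principal {(x, y). dist x y < e})"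
    by (rule uniformity_circle_def)
  show "open U \<longleftrightarrow> (\<forall>x\<in>U. \<forall>\<^sub>F (x', y) in uniformity. x' = x \<longrightarrow> y \<in> U)" for U :: "circle set"
    by (rule open_circle_def)
  show "dist x y = 0 \<longleftrightarrow> x = y" for x y :: circle
  proof transfer
    fix x y :: real
    show "infdist (x - y) \<int> = 0 \<longleftrightarrow> x - y \<in> \<int>"
      using in_closed_iff_infdist_zero[of "\<int> :: real set" "x - y"] Ints_0 closed_Ints by blast
  qed
  show "dist x y \<le> dist x z + dist y z" for x y z :: circle
  proof transfer
    fix x y z :: real
    show "infdist (x - y) \<int> \<le> infdist (x - z) \<int> + infdist (y - z) \<int>"
      using infdist_Ints_add_le[of "x - z" "z - y"] infdist_Ints_minus[of "y - z"] by simp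
  qed
qed

end

lemma dist_to_circle: "dist (to_circle x) (to_circle y) = infdist (x - y) \<int>"
  by (rule dist_circle.abs_eq)

lemma dist_to_circle_le: "dist (to_circle x) (to_circle y) \<le> dist x y"
  using infdist_Ints_le[of 0 "x - y"] by (simp add: dist_to_circle dist_real_def)

lemma continuous_on_to_circle: "continuous_on A to_circle"
  unfolding continuous_on_iff using dist_to_circle_le le_less_trans by blast

lemma to_circle_measurable [measurable]: "to_circle \<in> borel_measurable borel"
  by (rule borel_measurable_continuous_onI[OF continuous_on_to_circle])

definition circle_lebesgue :: "circle measure" where
  "circle_lebesgue = distr (restrict_space lborel {0..<1}) borel to_circle"

lemma prob_space_circle_lebesgue: "prob_space circle_lebesgue"
proof -
  have "prob_space (restrict_space lborel {0..<1 :: real})"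
    by (rule prob_spaceI) (simp add: space_restrict_space emeasure_restrict_space)
  then show ?thesis
    unfolding circle_lebesgue_def
    by (rule prob_space.prob_space_distr) (auto intro: measurable_restrict_space1)
qed

lift_definition open_arc :: "circle \<Rightarrow> real \<Rightarrow> circle set" is
  "\<lambda>w l. to_circle ` {w - l / 2 <..< w + l / 2}"
proof -
  have le: "to_circle ` {w - l / 2 <..< w + l / 2} \<subseteq> to_circle ` {w' - l / 2 <..< w' + l / 2}"
    if "w - w' \<in> \<int>" for w w' l :: real
  proof
    fix z assume "z \<in> to_circle ` {w - l / 2 <..< w + l / 2}"
    then obtain x where x: "z = to_circle x" "x \<in> {w - l / 2 <..< w + l / 2}" by auto
    have "z = to_circle (x - (w - w'))"
      using that by (simp add: x(1) circle.abs_eq_iff)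
    moreover have "x - (w - w') \<in> {w' - l / 2 <..< w' + l / 2}" using x(2) by auto
    ultimately show "z \<in> to_circle ` {w' - l / 2 <..< w' + l / 2}" by blast
  qed
  fix w w' :: real
  assume k: "w - w' \<in> \<int>"
  then have "w' - w \<in> \<int>" using Ints_minus[OF k] by simp
  then show "(\<lambda>l. to_circle ` {w - l / 2 <..< w + l / 2}) =
      (\<lambda>l. to_circle ` {w' - l / 2 <..< w' + l / 2})"
    using le k by (intro ext subset_antisym) auto
qed

lemma open_arc_eq_ball: "open_arc w l = ball w (l / 2)"
proof (induct w rule: circle.abs_induct)
  case (1 w)
  show ?case
  proof (rule set_eqI)
    fix z show "z \<in> open_arc (to_circle w) l \<longleftrightarrow> z \<in> ball (to_circle w) (l / 2)"
    proof (induct z rule: circle.abs_induct)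
      case (1 x)
      show ?case
      proof
        assume "to_circle x \<in> open_arc (to_circle w) l"
        then obtain y where y: "to_circle x = to_circle y" "y \<in> {w - l / 2 <..< w + l / 2}"
          by (auto simp: open_arc.abs_eq)
        have "dist w y < l / 2" using y(2) unfolding dist_real_def greaterThanLessThan_iff by linarith
        then show "to_circle x \<in> ball (to_circle w) (l / 2)"
          using dist_to_circle_le[of w y] y(1) by simp
      next
        assume "to_circle x \<in> ball (to_circle w) (l / 2)"
        then have d: "infdist (w - x) \<int> < l / 2" by (simp add: dist_to_circle)
        obtain k where k: "k \<in> \<int>" "infdist (w - x) \<int> = \<bar>w - x - k\<bar>"
          by (rule infdist_Ints_attained)
        have "to_circle x = to_circle (x + k)"
          using k(1) by (simp add: circle.abs_eq_iff)
        moreover have "x + k \<in> {w - l / 2 <..< w + l / 2}"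
          using d unfolding k(2) greaterThanLessThan_iff by linarith
        ultimately show "to_circle x \<in> open_arc (to_circle w) l" by (auto simp: open_arc.abs_eq)
      qed
    qed
  qed
qed

section \<open>Densities and Dvoretzky covering\<close>

definition prob_density :: "(circle \<Rightarrow> real) \<Rightarrow> bool" where
  "prob_density f \<longleftrightarrow> (\<forall>x. 0 \<le> f x) \<and> integrable circle_lebesgue f \<and>
     (\<integral>x. f x \<partial>circle_lebesgue) = 1"

definition density_measure :: "(circle \<Rightarrow> real) \<Rightarrow> circle measure" where
  "density_measure f = density circle_lebesgue (\<lambda>x. ennreal (f x))"

text \<open>
  The i.i.d. sequence is realised as the coordinate process on the infinite product space.
  Sequences are indexed by \<open>n \<ge> 1\<close>; the coordinate and the length of index \<open>0\<close> are
  present but do not influence the limsup of sets.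
\<close>

definition dvoretzky_covered :: "(circle \<Rightarrow> real) \<Rightarrow> (nat \<Rightarrow> real) \<Rightarrow> bool" where
  "dvoretzky_covered f l \<longleftrightarrow>
     (AE \<omega> in Pi\<^sub>M UNIV (\<lambda>n :: nat. density_measure f). limsup (\<lambda>n. open_arc (\<omega> n) (l n)) = UNIV)"

lemma limsup_open_arc_eq_UNIV_iff:
  "limsup (\<lambda>n. open_arc (\<omega> n) (l n)) = UNIV \<longleftrightarrow> (\<forall>x. \<exists>\<^sub>\<infinity>n. x \<in> open_arc (\<omega> n) (l n))"
  by (auto simp: limsup_INF_SUP INFM_nat_le set_eq_iff Bex_def)

text \<open>
  For \<open>f \<ge> 0\<close> and \<open>J\<close> of positive measure the supremum is over a nonempty set that is
  bounded above; otherwise the value of \<open>ess_inf\<close> is meaningless.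
\<close>

definition ess_inf :: "circle set \<Rightarrow> (circle \<Rightarrow> real) \<Rightarrow> real" where
  "ess_inf J f = Sup {a. AE x in circle_lebesgue. x \<in> J \<longrightarrow> a \<le> f x}"

definition min_level :: "(circle \<Rightarrow> real) \<Rightarrow> real" where
  "min_level f = ess_inf UNIV f"

definition min_set :: "(circle \<Rightarrow> real) \<Rightarrow> circle set" where
  "min_set f = {x. (\<lambda>n. ess_inf (ball x (1 / real n)) f) \<longlonglongrightarrow> min_level f}"

section \<open>Hausdorff and box-counting dimension\<close>

text \<open>Boundedness is required because \<^const>\<open>diameter\<close> is meaningless on unbounded sets.\<close>

definition hausdorff_premeasure :: "real \<Rightarrow> real \<Rightarrow> 'a::metric_space set \<Rightarrow> ennreal" where
  "hausdorff_premeasure s \<delta> Z =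
     (INF U\<in>{U :: nat \<Rightarrow> 'a set. Z \<subseteq> (\<Union>i. U i) \<and> (\<forall>i. bounded (U i) \<and> diameter (U i) \<le> \<delta>)}.
        \<Sum>i. ennreal (diameter (U i) powr s))"

definition hausdorff_outer :: "real \<Rightarrow> 'a::metric_space set \<Rightarrow> ennreal" where
  "hausdorff_outer s Z = (SUP \<delta>\<in>{0<..}. hausdorff_premeasure s \<delta> Z)"

text \<open>Only \<open>s > 0\<close> is used, which avoids the convention \<open>0 powr 0 = 0\<close> and does not change
  the infimum.\<close>

definition hausdorff_dim :: "'a::metric_space set \<Rightarrow> ereal" where
  "hausdorff_dim Z = (INF s\<in>{s. 0 < s \<and> hausdorff_outer s Z = 0}. ereal s)"

text \<open>Meaningful for totally bounded \<open>Z\<close>, in particular for every subset of the circle.\<close>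

definition covering_number :: "'a::metric_space set \<Rightarrow> real \<Rightarrow> nat" where
  "covering_number Z \<delta> =
     (LEAST k. \<exists>C. finite C \<and> card C = k \<and> Z \<subseteq> (\<Union>x\<in>C. ball x \<delta>))"

definition upper_box_dim :: "'a::metric_space set \<Rightarrow> ereal" where
  "upper_box_dim Z =
     Limsup (at_right 0) (\<lambda>\<delta>. ereal (ln (real (covering_number Z \<delta>)) / (- ln \<delta>)))"

end

theory Submission
  imports Defs "HOL-Real_Asymp.Real_Asymp"
begin

text \<open>
  Let \<open>f = m + dist(\<cdot>, K)\<close> for a Cantor set \<open>K\<close>, where \<open>m\<close> normalises the integral, so that
  \<open>K\<^sub>f = K\<close> and \<open>m\<^sub>f = m\<close>. The arc lengths are constant on blocks \<open>{n\<^sub>k + 1..n\<^sub>k\<^sub>+\<^sub>1}\<close> of very rapidly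
  growing length, slightly below the critical length \<open>ln n\<^sub>k\<^sub>+\<^sub>1 / (m n\<^sub>k\<^sub>+\<^sub>1)\<close>; this gives the condition on
  the limsup along \<open>n\<^sub>k\<close>. Each piece of \<open>K\<close> of level \<open>k\<close> has \<open>n\<^sub>k\<^sub>+\<^sub>1\<close> equally spaced children, up to
  subpolynomial factors, which forces the upper box dimension to be \<open>1\<close>, while the children are so
  short that the Hausdorff dimension is at most \<open>1 / 2\<close>. Near \<open>K\<close> the density is almost \<open>m\<close>, so in
  block \<open>k\<close> the expected number of children of a given piece that no arc meets is large, and by the
  second moment method some child is missed with probability close to \<open>1\<close>, uniformly enough for a
  union bound over all pieces and all levels. With positive probability there is then a nested
  sequence of missed pieces, which shrinks to an uncovered point.
\<close>

section \<open>The scales\<close>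

text \<open>\<open>M\<close> is taken of order \<open>n powr (1 - d / 2)\<close>. A child escapes
  \<open>n\<close> arcs of length \<open>lam'\<close> with probability about
  \<open>n powr (d - 1)\<close>, so about \<open>n powr (d / 2)\<close> children are expected to
  survive, which exceeds any \<open>C\<close>; yet the distance \<open>a / M\<close> still dominates
  \<open>ln n / n\<close>. Every requirement therefore holds for large \<open>n\<close>.\<close>

lemma scale_step:
  fixes a lam d C :: real and N n0 :: nat
  assumes "0 < a" "0 < lam" "1 \<le> N" "0 < d" "d < 1"
  obtains n M :: nat and a' lam' :: real where
    "n0 < n" "1 \<le> M" "lam' = (1 - d) * ln n / n" "a' = 1 / (real n * real (N * M)) ^ 4"
    "0 < lam'" "lam' < lam" "2 * lam' + 2 * a' \<le> a / M"
    "lam' + 2 * a' + 2 * (lam' + a')\<^sup>2 \<le> 1"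
    "C \<le> M * (1 - (lam' + 2 * a' + 2 * (lam' + a')\<^sup>2)) ^ n"
    "(1 - d) * ln (2 * M / a) \<le> ln M"
proof -
  define L where "L = (\<lambda>x::real. (1 - d) * ln x / x)"
  \<comment> \<open>\<open>P n\<close> is the hit bound with \<open>a'\<close> replaced by
    \<open>1 / n\<close>, so that the asymptotic conditions involve neither \<open>N\<close> nor the
    rounded \<open>M\<close>.\<close>
  define P where "P = (\<lambda>x. L x + 2 / x + 2 * (L x + 1 / x)\<^sup>2)"
  have d: "1 - d > 0" "1 - d / 2 > 0" using assms by auto
  have "\<forall>\<^sub>F x in at_top. real n0 < x \<and> 1 < x \<and> L x < lam \<and>
     2 * L x + 2 / x \<le> a / (2 * x powr (1 - d / 2)) \<and> P x < 1 \<and>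
     C \<le> x powr (1 - d / 2) * (1 - P x) powr x \<and> (1 - d) * ln (2 / a) \<le> d * ((1 - d / 2) * ln x)"
    unfolding L_def P_def
    by (intro eventually_conj eventually_gt_at_top) (use assms d in real_asymp)+
  then have "\<forall>\<^sub>F n in sequentially. real n0 < real n \<and> 1 < real n \<and> L n < lam \<and>
     2 * L n + 2 / n \<le> a / (2 * n powr (1 - d / 2)) \<and> P n < 1 \<and>
     C \<le> n powr (1 - d / 2) * (1 - P n) powr n \<and> (1 - d) * ln (2 / a) \<le> d * ((1 - d / 2) * ln n)"
    using filterlim_real_sequentially unfolding filterlim_iff by fast
  then obtain n :: nat where n: "n0 < n" "1 < n" "L n < lam"
     "2 * L n + 2 / n \<le> a / (2 * n powr (1 - d / 2))" "P n < 1"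
     "C \<le> n powr (1 - d / 2) * (1 - P n) powr n" "(1 - d) * ln (2 / a) \<le> d * ((1 - d / 2) * ln n)"
    by (auto simp: eventually_sequentially)
  define y where "y = n powr (1 - d / 2)"
  define M where "M = nat \<lceil>y\<rceil>"
  have y1: "1 \<le> y" unfolding y_def using n(2) d by (intro ge_one_powr_ge_zero) auto
  \<comment> \<open>Rounding up costs at most a factor 2 because \<open>y\<close> is at least 1; the
    asymptotic gap condition has this factor built in.\<close>
  have My: "y \<le> M" "M \<le> 2 * y" unfolding M_def using y1 by linarith+
  then have M1: "1 \<le> M" using y1 by linarith
  define a' where "a' = 1 / (real n * real (N * M)) ^ 4"
  have NM: "1 \<le> N * M" using M1 assms(3) by simp
  then have "1 \<le> real (N * M)" by linarith
  then have "real n * 1 \<le> real n * real (N * M)" by (rule mult_left_mono) simp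
  then have nNM: "n \<le> real n * real (N * M)" by simp
  also have "\<dots> \<le> (real n * real (N * M)) ^ 4"
    using power_increasing[of 1 4 "real n * real (N * M)"] nNM n(2) by (simp del: of_nat_mult)
  finally have a': "a' \<le> 1 / n" "0 < a'"
    unfolding a'_def using n(2) NM by (auto intro!: divide_left_mono mult_pos_pos)
  have L: "0 < L n" unfolding L_def using n(2) d by simp
  define p where "p = L n + 2 * a' + 2 * (L n + a')\<^sup>2"
  have "(L n + a')\<^sup>2 \<le> (L n + 1 / n)\<^sup>2" using a' L by (intro power_mono) auto
  then have pP: "p \<le> P n" unfolding p_def P_def using a' by simp
  show ?thesis
  proof
    show "2 * L n + 2 * a' \<le> a / M"
    proof -
      have "a / (2 * y) \<le> a / M" using My y1 assms(1) by (intro divide_left_mono) auto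
      then show ?thesis using n(4) a' unfolding y_def by simp
    qed
    show "C \<le> M * (1 - (L n + 2 * a' + 2 * (L n + a')\<^sup>2)) ^ n"
    proof -
      have "C \<le> y * (1 - P n) ^ n" using n(5,6) by (simp add: y_def powr_realpow)
      also have "\<dots> \<le> M * (1 - p) ^ n"
        using My pP n(5) y1 by (intro mult_mono power_mono) auto
      finally show ?thesis unfolding p_def .
    qed
    show "(1 - d) * ln (2 * M / a) \<le> ln M"
    proof -
      have "ln y \<le> ln M" using My y1 by simp
      then have "d * ((1 - d / 2) * ln n) \<le> d * ln M"
        unfolding y_def using n(2) assms(4) by (simp add: ln_powr)
      moreover have "ln (2 * M / a) = ln (2 / a) + ln M"
        using M1 assms(1) ln_mult[of "2 / a" "real M"] by simp
      ultimately show ?thesis using n(7) by (simp add: algebra_simps)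
    qed
  qed (use n pP M1 L in \<open>auto simp: L_def a'_def p_def\<close>)
qed

text \<open>
  Level \<open>k\<close> of the Cantor set has at most \<open>N k\<close> pieces of length \<open>a k\<close>, each with \<open>M k\<close> children at
  distance \<open>a k / M k\<close>. Up to the factor \<open>1 / min_level f\<close>, which is only known once the Cantor set is
  constructed, the arcs with index in \<open>{n k<..n (Suc k)}\<close> have length \<open>lam (Suc k)\<close>. The expression
  in \<open>hit_le_1\<close> and \<open>miss\<close> bounds the probability that such an arc meets a given child, whatever the
  value of \<open>min_level f\<close> in \<open>{1 / 2..1}\<close>; \<open>gap\<close> makes these events disjoint for different children.
\<close>

locale cantor_scheme =
  fixes n M N :: "nat \<Rightarrow> nat" and a lam :: "nat \<Rightarrow> real"
  assumes n_0: "n 0 = 0" and N_0: "N 0 = 1" and a_0: "a 0 = 1 / 2" and lam_0: "lam 0 = 1 / 2"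
    and n_less: "n k < n (Suc k)"
    and M_pos: "0 < M k"
    and N_Suc: "N (Suc k) = N k * M k"
    and a_Suc: "a (Suc k) = 1 / (real (n (Suc k)) * real (N (Suc k))) ^ 4"
    and lam_pos: "0 < lam k"
    and lam_less: "lam (Suc k) < lam k"
    and lam_ge: "(1 - 1 / (real k + 2)) * ln (n (Suc k)) \<le> n (Suc k) * lam (Suc k)"
    and gap: "2 * lam (Suc k) + 2 * a (Suc k) \<le> a k / M k"
    and hit_le_1: "lam (Suc k) + 2 * a (Suc k) + 2 * (lam (Suc k) + a (Suc k))\<^sup>2 \<le> 1"
    and miss: "real (N k) * 2 ^ (k + 2) \<le>
      M k * (1 - (lam (Suc k) + 2 * a (Suc k) + 2 * (lam (Suc k) + a (Suc k))\<^sup>2)) ^ n (Suc k)"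
    and box: "(1 - 1 / (real k + 2)) * ln (2 * M k / a k) \<le> ln (M k)"

text \<open>Dependent choice on the state \<open>(n, N, a, lam)\<close>. The number
  \<open>M k\<close> belongs to the transition from level \<open>k\<close> to the next and is
  extracted afterwards.\<close>

lemma cantor_scheme_exists: "\<exists>n M N a lam. cantor_scheme n M N a lam"
proof -
  define inv :: "nat \<times> nat \<times> real \<times> real \<Rightarrow> bool" where
    "inv = (\<lambda>(n, N, a, lam). 1 \<le> N \<and> 0 < a \<and> 0 < lam)"
  define step :: "nat \<Rightarrow> nat \<Rightarrow> nat \<times> nat \<times> real \<times> real \<Rightarrow> nat \<times> nat \<times> real \<times> real \<Rightarrow> bool" where
    "step = (\<lambda>k (M :: nat) (n :: nat, N :: nat, a :: real, lam :: real) (n' :: nat, N' :: nat, a' :: real, lam' :: real).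
       n < n' \<and> 0 < M \<and> N' = N * M \<and> a' = 1 / (real n' * real N') ^ 4 \<and> lam' < lam \<and>
       (1 - 1 / (real k + 2)) * ln n' \<le> n' * lam' \<and>
       2 * lam' + 2 * a' \<le> a / M \<and> lam' + 2 * a' + 2 * (lam' + a')\<^sup>2 \<le> 1 \<and>
       real N * 2 ^ (k + 2) \<le> M * (1 - (lam' + 2 * a' + 2 * (lam' + a')\<^sup>2)) ^ n' \<and>
       (1 - 1 / (real k + 2)) * ln (2 * M / a) \<le> ln M)"
  have "\<exists>y. inv y \<and> (\<exists>M. step k M x y)" if "inv x" for x k
  proof -
    obtain n N a lam where x: "x = (n, N, a, lam)" by (cases x) auto
    have pos: "0 < a" "0 < lam" "1 \<le> N" using that by (auto simp: x inv_def)
    \<comment> \<open>The loss \<open>d = 1 / (k + 2)\<close> lies in \<open>(0, 1)\<close> and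
      tends to 0, so that it disappears in the limsup condition and in the box dimension. The
      constant \<open>C\<close> leaves each of the \<open>N\<close> pieces a failure probability of
      at most \<open>1 / (N * 2 ^ (k + 2))\<close>.\<close>
    obtain n' M a' lam' where *: "n < n'" "1 \<le> M" "lam' = (1 - 1 / (real k + 2)) * ln (real n') / real n'"
        "a' = 1 / (real n' * real (N * M)) ^ 4"
        "0 < lam'" "lam' < lam" "2 * lam' + 2 * a' \<le> a / M"
        "lam' + 2 * a' + 2 * (lam' + a')\<^sup>2 \<le> 1"
        "real N * 2 ^ (k + 2) \<le> M * (1 - (lam' + 2 * a' + 2 * (lam' + a')\<^sup>2)) ^ n'"
        "(1 - 1 / (real k + 2)) * ln (2 * M / a) \<le> ln M"
      by (rule scale_step[OF pos, of "1 / (real k + 2)" n "real N * 2 ^ (k + 2)"]) auto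
    have "0 < n'" using *(1) by simp
    have "inv (n', N * M, a', lam')"
      using * pos \<open>0 < n'\<close> by (auto simp: inv_def)
    moreover have "step k M x (n', N * M, a', lam')"
      unfolding step_def x using * \<open>0 < n'\<close> by auto
    ultimately show ?thesis by blast
  qed
  then have ex: "\<And>x k. inv x \<Longrightarrow> \<exists>y. inv y \<and> (\<exists>M. step k M x y)" .
  have base: "inv (0, 1, 1/2, 1/2)" by (simp add: inv_def)
  \<comment> \<open>The clause for \<open>k = 0\<close> pins the initial state, which dependent
    choice alone would leave open.\<close>
  have "\<exists>X. \<forall>k. (inv (X k) \<and> (k = 0 \<longrightarrow> X k = (0, 1, 1/2, 1/2))) \<and> (\<exists>M. step k M (X k) (X (Suc k)))"
  proof (rule dependent_nat_choice)
    show "\<exists>x. inv x \<and> (0 = (0::nat) \<longrightarrow> x = (0, 1, 1/2, 1/2))" using base by blast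
  qed (use ex in auto)
  then obtain X where X: "\<And>k. inv (X k)" "X 0 = (0, 1, 1/2, 1/2)"
      "\<And>k. \<exists>M. step k M (X k) (X (Suc k))" by blast
  then obtain M where M: "\<And>k. step k (M k) (X k) (X (Suc k))" by metis
  define n N a lam where "n k = fst (X k)" "N k = fst (snd (X k))" "a k = fst (snd (snd (X k)))"
    "lam k = snd (snd (snd (X k)))" for k
  note defs = this
  have "step k (M k) (n k, N k, a k, lam k) (n (Suc k), N (Suc k), a (Suc k), lam (Suc k))" for k
    using M[of k] by (simp add: defs)
  note S = this[unfolded step_def prod.case]
  have "0 < lam k" for k using X(1)[of k] by (simp add: defs inv_def case_prod_beta)
  moreover have "n 0 = 0" "N 0 = 1" "a 0 = 1 / 2" "lam 0 = 1 / 2" using X(2) by (simp_all add: defs)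
  ultimately have "cantor_scheme n M N a lam"
    unfolding cantor_scheme_def using S by (intro conjI allI) (assumption | elim meta_allE conjE, assumption)+
  then show ?thesis by blast
qed

section \<open>The second moment method\<close>

text \<open>Chebyshev's inequality for the number \<open>X\<close> of events that occur. Negative
  correlation bounds its variance by its mean \<open>Q\<close>, and where no event occurs
  \<open>X\<close> deviates from its mean by exactly \<open>Q\<close>.\<close>

lemma (in prob_space) prob_none_le:
  assumes "finite J" and A: "\<And>j. j \<in> J \<Longrightarrow> A j \<in> events"
    and neg: "\<And>i j. i \<in> J \<Longrightarrow> j \<in> J \<Longrightarrow> i \<noteq> j \<Longrightarrow> prob (A i \<inter> A j) \<le> prob (A i) * prob (A j)"
  shows "(\<Sum>j\<in>J. prob (A j)) * prob (space M - (\<Union>j\<in>J. A j)) \<le> 1"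
proof -
  define Q where "Q = (\<Sum>j\<in>J. prob (A j))"
  define X where "X \<omega> = (\<Sum>j\<in>J. indicator (A j) \<omega> :: real)" for \<omega>
  define B where "B = space M - (\<Union>j\<in>J. A j)"
  have B: "B \<in> events" unfolding B_def using assms by (intro sets.Diff sets.finite_UN) auto
  have Q0: "0 \<le> Q" unfolding Q_def by (intro sum_nonneg) auto
  have X_sq: "(X \<omega>)\<^sup>2 = (\<Sum>i\<in>J. \<Sum>j\<in>J. indicator (A i \<inter> A j) \<omega>)" for \<omega>
    unfolding X_def power2_eq_square sum_product by (simp add: indicator_inter_arith)
  have int: "integrable M (\<lambda>\<omega>. indicator (A i \<inter> A j) \<omega> :: real)" if "i \<in> J" "j \<in> J" for i j
    using A that by (intro integrable_real_indicator) (auto simp: emeasure_eq_measure)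
  have int1: "integrable M (\<lambda>\<omega>. indicator (A j) \<omega> :: real)" if "j \<in> J" for j
    using int[OF that that] by simp
  have intX: "integrable M X" "integrable M (\<lambda>\<omega>. (X \<omega>)\<^sup>2)"
    unfolding X_sq unfolding X_def by (intro Bochner_Integration.integrable_sum int int1; assumption)+
  have EX: "expectation X = Q"
    unfolding X_def Q_def using A int1
    by (subst Bochner_Integration.integral_sum) (auto intro!: sum.cong)
  have "expectation (\<lambda>\<omega>. (X \<omega>)\<^sup>2) = (\<Sum>i\<in>J. \<Sum>j\<in>J. prob (A i \<inter> A j))"
    unfolding X_sq using A int
    by (subst Bochner_Integration.integral_sum; (intro sum.cong refl Bochner_Integration.integrable_sum)?)+ auto
  \<comment> \<open>The hypothesis covers only distinct indices; the extra term accounts for the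
    diagonal and sums to \<open>Q\<close>.\<close>
  also have "\<dots> \<le> (\<Sum>i\<in>J. \<Sum>j\<in>J. prob (A i) * prob (A j) + (if i = j then prob (A i) else 0))"
  proof (intro sum_mono)
    fix i j assume "i \<in> J" "j \<in> J"
    then show "prob (A i \<inter> A j) \<le> prob (A i) * prob (A j) + (if i = j then prob (A i) else 0)"
      using neg[of i j] by (cases "i = j") auto
  qed
  also have "\<dots> = Q\<^sup>2 + Q"
    unfolding Q_def power2_eq_square sum_product using \<open>finite J\<close>
    by (simp add: sum.distrib sum.delta)
  finally have EX2: "expectation (\<lambda>\<omega>. (X \<omega>)\<^sup>2) \<le> Q\<^sup>2 + Q" .
  have sq: "(X \<omega> - Q)\<^sup>2 = (X \<omega>)\<^sup>2 - 2 * Q * X \<omega> + Q\<^sup>2" for \<omega>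
    by (simp add: power2_eq_square algebra_simps)
  have "Q\<^sup>2 * prob B = expectation (\<lambda>\<omega>. Q\<^sup>2 * indicator B \<omega>)" using B by simp
  also have "\<dots> \<le> expectation (\<lambda>\<omega>. (X \<omega> - Q)\<^sup>2)"
  proof (rule integral_mono)
    show "integrable M (\<lambda>\<omega>. Q\<^sup>2 * indicator B \<omega>)"
      using B by (intro integrable_mult_right integrable_real_indicator) (auto simp: emeasure_eq_measure)
    show "integrable M (\<lambda>\<omega>. (X \<omega> - Q)\<^sup>2)" unfolding sq using intX by auto
    fix \<omega> assume "\<omega> \<in> space M"
    have "X \<omega> = 0" if "\<omega> \<in> B" using that unfolding X_def B_def by (intro sum.neutral) auto
    then show "Q\<^sup>2 * indicator B \<omega> \<le> (X \<omega> - Q)\<^sup>2" by (auto simp: indicator_def)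
  qed
  also have "\<dots> = expectation (\<lambda>\<omega>. (X \<omega>)\<^sup>2) - 2 * Q * Q + Q\<^sup>2"
    unfolding sq using intX by (simp add: EX prob_space)
  also have "\<dots> \<le> Q" using EX2 by (simp add: power2_eq_square)
  finally have "Q * (Q * prob B) \<le> Q * 1" by (simp add: power2_eq_square algebra_simps)
  then have "Q * prob B \<le> 1" using Q0 by (cases "Q = 0") (auto simp: mult_le_cancel_left)
  then show ?thesis unfolding Q_def B_def .
qed

lemma (in product_prob_space) measure_PiM_Collect:
  assumes "J \<subseteq> I" "finite J" "\<And>i. i \<in> J \<Longrightarrow> X i \<in> sets (M i)"
  shows "measure (Pi\<^sub>M I M) {x \<in> space (Pi\<^sub>M I M). \<forall>i\<in>J. x i \<in> X i} = (\<Prod>i\<in>J. measure (M i) (X i))"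
  using emeasure_PiM_Collect[OF assms(1,2), of X] assms(3)
  by (simp add: emeasure_eq_measure M.emeasure_eq_measure prod_ennreal measure_nonneg prod_nonneg)

text \<open>The second moment bound is applied to the events \<open>A (U j)\<close> that no sample
  with index in \<open>I\<close> falls into \<open>U j\<close>. Independence makes their
  probabilities powers, and disjointness of the sets gives negative correlation through
  \<open>1 - (x + y) \<le> (1 - x) * (1 - y)\<close>.\<close>

lemma prob_all_hit_le:
  fixes p :: real
  assumes D: "prob_space D" and fin: "finite I" "finite J"
    and U: "\<And>j. j \<in> J \<Longrightarrow> U j \<in> sets D" and disj: "disjoint_family_on U J"
    and p: "\<And>j. j \<in> J \<Longrightarrow> measure D (U j) \<le> p" "p \<le> 1"
  shows "card J * (1 - p) ^ card I *
    measure (Pi\<^sub>M UNIV (\<lambda>_ :: 'i. D)) {\<omega> \<in> space (Pi\<^sub>M UNIV (\<lambda>_. D)). \<forall>j\<in>J. \<exists>i\<in>I. \<omega> i \<in> U j} \<le> 1"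
proof -
  interpret D: prob_space D by fact
  interpret W: product_prob_space "\<lambda>_ :: 'i. D" UNIV ..
  let ?W = "Pi\<^sub>M UNIV (\<lambda>_ :: 'i. D)"
  define A where "A V = {\<omega> \<in> space ?W. \<forall>i\<in>I. \<omega> i \<in> space D - V}" for V
  have A_sets: "A V \<in> sets ?W" if "V \<in> sets D" for V
    using that fin unfolding A_def by measurable
  have A_prob: "measure ?W (A V) = (1 - measure D V) ^ card I" if "V \<in> sets D" for V
    unfolding A_def using that fin
    by (subst W.measure_PiM_Collect) (auto simp: D.prob_compl)
  have "(\<Sum>j\<in>J. measure ?W (A (U j))) * measure ?W (space ?W - (\<Union>j\<in>J. A (U j))) \<le> 1"
  proof (rule W.prob_none_le)
    fix i j assume ij: "i \<in> J" "j \<in> J" "i \<noteq> j"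
    have "A (U i) \<inter> A (U j) = A (U i \<union> U j)" unfolding A_def by auto
    moreover have "measure D (U i \<union> U j) = measure D (U i) + measure D (U j)"
      using ij U disj by (intro D.finite_measure_Union) (auto simp: disjoint_family_on_def)
    moreover have "1 - (x + y) \<le> (1 - x) * (1 - y)" if "0 \<le> x" "0 \<le> y" for x y :: real
      using that by (simp add: algebra_simps)
    moreover have "0 \<le> 1 - measure D (U i \<union> U j)" by simp
    ultimately show "measure ?W (A (U i) \<inter> A (U j)) \<le> measure ?W (A (U i)) * measure ?W (A (U j))"
      using ij U by (simp add: A_prob power_mult_distrib[symmetric] power_mono)
  qed (use fin U A_sets in auto)
  moreover have "space ?W - (\<Union>j\<in>J. A (U j)) = {\<omega> \<in> space ?W. \<forall>j\<in>J. \<exists>i\<in>I. \<omega> i \<in> U j}"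
    unfolding A_def by (fastforce simp: space_PiM)
  moreover have "card J * (1 - p) ^ card I \<le> (\<Sum>j\<in>J. measure ?W (A (U j)))"
  proof -
    have "(\<Sum>j\<in>J. (1 - p) ^ card I) \<le> (\<Sum>j\<in>J. measure ?W (A (U j)))"
      using p U by (intro sum_mono) (auto simp: A_prob intro!: power_mono)
    then show ?thesis by simp
  qed
  ultimately show ?thesis
    by (smt (verit) measure_nonneg mult_right_mono)
qed

section \<open>Lebesgue measure and essential infima on the circle\<close>

lemma dist_to_circle_eq:
  assumes "\<bar>x - y\<bar> \<le> 1 / 2"
  shows "dist (to_circle x) (to_circle y) = \<bar>x - y\<bar>"
proof -
  obtain k where k: "k \<in> \<int>" "infdist (x - y) \<int> = \<bar>x - y - k\<bar>" by (rule infdist_Ints_attained)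
  have "\<bar>x - y\<bar> \<le> \<bar>x - y - k\<bar>"
  proof (cases "k = 0")
    case False
    then have "1 \<le> \<bar>k\<bar>" by (rule Ints_nonzero_abs_ge1[OF k(1)])
    then show ?thesis using assms by linarith
  qed simp
  then show ?thesis
    using k(2) infdist_Ints_le[of 0 "x - y"] by (simp add: dist_to_circle)
qed

lemma circle_cases:
  obtains y where "0 \<le> y" "y < 1" "x = to_circle y"
proof (induct x rule: circle.abs_induct)
  case (1 z)
  have "z - frac z \<in> \<int>" by (simp add: frac_def)
  then have "to_circle z = to_circle (frac z)" by (simp add: circle.abs_eq_iff)
  then show ?case using 1[of "frac z"] frac_ge_0[of z] frac_lt_1[of z] by simp
qed

interpretation circle_lebesgue: prob_space circle_lebesgue
  by (rule prob_space_circle_lebesgue)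

lemma sets_circle_lebesgue [simp, measurable_cong]: "sets circle_lebesgue = sets borel"
  by (simp add: circle_lebesgue_def)

lemma space_circle_lebesgue [simp]: "space circle_lebesgue = UNIV"
  by (simp add: circle_lebesgue_def)

lemma measure_circle_lebesgue_UNIV: "measure circle_lebesgue UNIV = 1"
  using circle_lebesgue.prob_space by simp

lemma emeasure_circle_lebesgue:
  assumes "A \<in> sets borel"
  shows "emeasure circle_lebesgue A = emeasure lborel (to_circle -` A \<inter> {0..<1})"
proof -
  have "to_circle \<in> restrict_space lborel {0..<1} \<rightarrow>\<^sub>M borel"
    by (rule measurable_restrict_space1) simp
  then show ?thesis
    using assms unfolding circle_lebesgue_def
    by (simp add: emeasure_distr space_restrict_space emeasure_restrict_space)
qed

lemma emeasure_circle_lebesgue_open_pos: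
  assumes "open U" "U \<noteq> {}"
  shows "0 < emeasure circle_lebesgue U"
proof -
  obtain x where "x \<in> U" using assms by auto
  obtain y where y: "0 \<le> y" "y < 1" "x = to_circle y" by (rule circle_cases)
  have "open (to_circle -` U)"
    using continuous_on_to_circle[of UNIV] assms(1) by (rule open_vimage[rotated])
  then obtain e where e: "0 < e" "ball y e \<subseteq> to_circle -` U"
    by (rule openE[of _ y]) (use y \<open>x \<in> U\<close> in auto)
  \<comment> \<open>Moving only to the right of \<open>y\<close> stays inside the fundamental domain
    even when \<open>y = 0\<close>.\<close>
  define b where "b = min 1 (y + e)"
  have "{y..<b} \<subseteq> to_circle -` U \<inter> {0..<1}"
    using e y unfolding b_def by (auto simp: dist_real_def subset_iff)
  moreover have "to_circle -` U \<inter> {0..<1} \<in> sets lborel"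
    using measurable_sets[OF to_circle_measurable, of U] assms(1) by simp
  ultimately have "emeasure lborel {y..<b} \<le> emeasure circle_lebesgue U"
    using assms(1) by (simp add: emeasure_circle_lebesgue emeasure_mono)
  moreover have "0 < emeasure lborel {y..<b}" using e y by (simp add: b_def)
  ultimately show ?thesis by (rule less_le_trans[rotated])
qed

text \<open>The bounds on \<open>t\<close> and \<open>r\<close> keep the arc away from the cut of the circle at \<open>0\<close>.\<close>

lemma measure_circle_lebesgue_ball_le:
  assumes "1 / 4 \<le> t" "t \<le> 3 / 4" "0 \<le> r" "r \<le> 1 / 4"
  shows "measure circle_lebesgue (ball (to_circle t) r) \<le> 2 * r"
proof -
  have "to_circle -` ball (to_circle t) r \<inter> {0..<1} \<subseteq> {t - r<..<t + r}"
  proof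
    fix y assume "y \<in> to_circle -` ball (to_circle t) r \<inter> {0..<1}"
    then have y: "infdist (t - y) \<int> < r" "0 \<le> y" "y < 1" by (auto simp: dist_to_circle)
    obtain k where k: "k \<in> \<int>" "infdist (t - y) \<int> = \<bar>t - y - k\<bar>" by (rule infdist_Ints_attained)
    have "k = 0" using Ints_nonzero_abs_ge1[OF k(1)] k(2) y assms by linarith
    then show "y \<in> {t - r<..<t + r}" using k y by auto
  qed
  then have "emeasure circle_lebesgue (ball (to_circle t) r) \<le> emeasure lborel {t - r<..<t + r}"
    by (subst emeasure_circle_lebesgue) (auto intro!: emeasure_mono)
  also have "\<dots> = ennreal (2 * r)" using assms by simp
  finally show ?thesis
    using assms by (simp add: circle_lebesgue.emeasure_eq_measure)
qed

section \<open>Essential infima of continuous functions\<close>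

text \<open>The part of \<open>U\<close> where \<open>f\<close> is below \<open>c\<close> is open,
  and a null open set is empty.\<close>

lemma AE_circle_lebesgue_open_le:
  fixes f :: "circle \<Rightarrow> real"
  assumes "AE x in circle_lebesgue. x \<in> U \<longrightarrow> c \<le> f x" "open U" "continuous_on UNIV f" "x \<in> U"
  shows "c \<le> f x"
proof (rule ccontr)
  assume "\<not> c \<le> f x"
  define V where "V = U \<inter> f -` {..<c}"
  have V: "open V" unfolding V_def using assms by (intro open_Int open_vimage) auto
  have "AE x in circle_lebesgue. x \<notin> V" using assms(1) by (auto simp: V_def)
  then have "emeasure circle_lebesgue V = 0"
    using V AE_iff_measurable[of V circle_lebesgue "\<lambda>x. x \<notin> V"] by simp
  moreover have "x \<in> V" using assms(4) \<open>\<not> c \<le> f x\<close> by (simp add: V_def)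
  ultimately show False using emeasure_circle_lebesgue_open_pos[OF V] by auto
qed

lemma ess_inf_open:
  fixes f :: "circle \<Rightarrow> real"
  assumes "open U" "continuous_on UNIV f"
  shows "ess_inf U f = Sup {c. \<forall>x\<in>U. c \<le> f x}"
proof -
  have "(AE x in circle_lebesgue. x \<in> U \<longrightarrow> c \<le> f x) \<longleftrightarrow> (\<forall>x\<in>U. c \<le> f x)" for c
    by (intro iffI ballI) (rule AE_circle_lebesgue_open_le[OF _ assms], assumption, assumption, simp)
  then show ?thesis by (simp add: ess_inf_def)
qed

lemma min_level_add_infdist:
  fixes D :: "circle set"
  assumes "D \<noteq> {}"
  shows "min_level (\<lambda>x. m + infdist x D) = m"
proof -
  have "min_level (\<lambda>x. m + infdist x D) = Sup {c. \<forall>x. c \<le> m + infdist x D}"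
    unfolding min_level_def by (subst ess_inf_open) (auto intro!: continuous_intros)
  also have "{c. \<forall>x. c \<le> m + infdist x D} = {..m}"
  proof (intro set_eqI iffI)
    fix c assume c: "c \<in> {c. \<forall>x. c \<le> m + infdist x D}"
    obtain x where "x \<in> D" using assms by auto
    then show "c \<in> {..m}" using c by (auto dest!: spec[of _ x])
  next
    fix c assume "c \<in> {..m}"
    then have "c \<le> m + infdist x D" for x using infdist_nonneg[of x D] by simp
    then show "c \<in> {c. \<forall>x. c \<le> m + infdist x D}" by blast
  qed
  also have "Sup {..m} = m" by (rule cSup_atMost)
  finally show ?thesis .
qed

text \<open>The function is 1-Lipschitz, so its essential infimum over a ball of radius
  \<open>1 / n\<close> lies within \<open>1 / n\<close> of its value at the centre. The limit in
  \<open>min_set\<close> is therefore that value, which equals \<open>m\<close> exactly at distance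
  0 from \<open>D\<close>.\<close>

lemma min_set_add_infdist:
  fixes D :: "circle set"
  assumes "D \<noteq> {}"
  shows "min_set (\<lambda>x. m + infdist x D) = closure D"
proof -
  let ?f = "\<lambda>x. m + infdist x D"
  have "(\<lambda>n. ess_inf (ball x (1 / real n)) ?f) \<longlonglongrightarrow> ?f x" for x
  proof (rule tendsto_sandwich)
    \<comment> \<open>For \<open>n = 0\<close> the radius \<open>1 / 0\<close> is 0 and the ball is
      empty, hence the restriction to positive \<open>n\<close>.\<close>
    have bounds: "?f x - 1 / n \<le> ess_inf (ball x (1 / real n)) ?f \<and> ess_inf (ball x (1 / real n)) ?f \<le> ?f x"
      if "n > 0" for n :: nat
    proof -
      let ?S = "{c. \<forall>y\<in>ball x (1 / real n). c \<le> ?f y}"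
      have x: "x \<in> ball x (1 / real n)" using that by simp
      have "?f x - 1 / n \<le> ?f y" if "y \<in> ball x (1 / real n)" for y
        using that infdist_triangle[of x D y] by (simp add: dist_commute)
      then have lower: "?f x - 1 / n \<in> ?S" by blast
      moreover have "bdd_above ?S" using x by (intro bdd_aboveI[of _ "?f x"]) blast
      ultimately have "?f x - 1 / n \<le> Sup ?S" by (rule cSup_upper)
      moreover have "Sup ?S \<le> ?f x" using x lower by (intro cSup_least) blast+
      ultimately show ?thesis by (subst (1 2) ess_inf_open) (auto intro!: continuous_intros)
    qed
    show "\<forall>\<^sub>F n in sequentially. ?f x - 1 / n \<le> ess_inf (ball x (1 / real n)) ?f"
      "\<forall>\<^sub>F n in sequentially. ess_inf (ball x (1 / real n)) ?f \<le> ?f x"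
      using bounds by (auto intro!: eventually_sequentiallyI[of 1])
    show "(\<lambda>n. ?f x - 1 / real n) \<longlonglongrightarrow> ?f x" by real_asymp
  qed auto
  note lim = this
  have "x \<in> min_set ?f \<longleftrightarrow> ?f x = m" for x
    unfolding min_set_def min_level_add_infdist[OF assms] mem_Collect_eq
    using LIMSEQ_unique[OF lim[of x], of m] lim[of x] by (intro iffI) (assumption | simp)+
  then show ?thesis
    using in_closure_iff_infdist_zero[OF assms] by auto
qed

section \<open>Dimensions\<close>

lemma covering_number_le:
  assumes "finite C" "Z \<subseteq> (\<Union>x\<in>C. ball x \<delta>)"
  shows "covering_number Z \<delta> \<le> card C"
  unfolding covering_number_def using assms by (intro Least_le) blast

text \<open>The given finite cover ensures that the \<open>LEAST\<close> in the definition ranges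
  over a nonempty set.\<close>

lemma covering_number_attained:
  assumes "finite C" "Z \<subseteq> (\<Union>x\<in>C. ball x \<delta>)"
  obtains C' where "finite C'" "card C' = covering_number Z \<delta>" "Z \<subseteq> (\<Union>x\<in>C'. ball x \<delta>)"
proof -
  have "\<exists>C'. finite C' \<and> card C' = covering_number Z \<delta> \<and> Z \<subseteq> (\<Union>x\<in>C'. ball x \<delta>)"
    unfolding covering_number_def by (rule LeastI_ex) (use assms in blast)
  then show ?thesis using that by blast
qed

lemma circle_finite_cover:
  assumes "0 < \<delta>"
  obtains C :: "circle set" where "finite C" "card C \<le> 1 / \<delta> + 1" "UNIV \<subseteq> (\<Union>x\<in>C. ball x \<delta>)"
proof -
  let ?c = "\<lambda>i :: nat. to_circle (real i * \<delta>)"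
  let ?C = "?c ` {..nat \<lfloor>1 / \<delta>\<rfloor>}"
  have "card ?C \<le> Suc (nat \<lfloor>1 / \<delta>\<rfloor>)" by (rule order_trans[OF card_image_le]) auto
  moreover have "real (nat \<lfloor>1 / \<delta>\<rfloor>) \<le> 1 / \<delta>" using assms by simp
  ultimately have "card ?C \<le> 1 / \<delta> + 1" by linarith
  moreover have "x \<in> (\<Union>z\<in>?C. ball z \<delta>)" for x
  proof -
    obtain y where y: "0 \<le> y" "y < 1" "x = to_circle y" by (rule circle_cases)
    define i where "i = nat \<lfloor>y / \<delta>\<rfloor>"
    have i: "real i \<le> y / \<delta>" "y / \<delta> < real i + 1"
      using y(1) assms of_int_floor_le[of "y / \<delta>"] floor_correct[of "y / \<delta>"] divide_nonneg_pos[of y \<delta>]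
      unfolding i_def by simp_all
    then have "\<bar>real i * \<delta> - y\<bar> < \<delta>" using assms by (simp add: field_simps)
    then have "x \<in> ball (?c i) \<delta>"
      using dist_to_circle_le[of "real i * \<delta>" y] by (simp add: y dist_real_def)
    moreover have "i \<le> nat \<lfloor>1 / \<delta>\<rfloor>"
      unfolding i_def using y assms by (intro nat_mono floor_mono divide_right_mono) auto
    ultimately show ?thesis by blast
  qed
  ultimately show ?thesis by (intro that[of ?C]) auto
qed

lemma upper_box_dim_circle_le: "upper_box_dim (Z :: circle set) \<le> 1"
proof -
  have "upper_box_dim Z \<le> Limsup (at_right 0) (\<lambda>\<delta>. ereal (ln (1 / \<delta> + 1) / (- ln \<delta>)))"
    unfolding upper_box_dim_def
  proof (rule Limsup_mono)
    have "\<forall>\<^sub>F \<delta> in at_right 0. 0 < \<delta> \<and> \<delta> < (1::real)"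
      using eventually_at_right_real[of 0 1] by simp
    then show "\<forall>\<^sub>F \<delta> in at_right 0.
      ereal (ln (real (covering_number Z \<delta>)) / (- ln \<delta>)) \<le> ereal (ln (1 / \<delta> + 1) / (- ln \<delta>))"
    proof eventually_elim
      case (elim \<delta>)
      obtain C :: "circle set" where C: "finite C" "card C \<le> 1 / \<delta> + 1" "UNIV \<subseteq> (\<Union>x\<in>C. ball x \<delta>)"
        using circle_finite_cover[of \<delta>] elim by metis
      have "real (covering_number Z \<delta>) \<le> 1 / \<delta> + 1"
        using covering_number_le[OF C(1) order_trans[OF subset_UNIV C(3)], of Z] C(2) by linarith
      \<comment> \<open>The covering number is 0 when \<open>Z\<close> is empty; that case rests on
        the convention \<open>ln 0 = 0\<close>.\<close>
      then have "ln (real (covering_number Z \<delta>)) \<le> ln (1 / \<delta> + 1)"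
        using elim by (cases "covering_number Z \<delta> = 0") (simp_all add: ln_ge_zero)
      then have "ln (real (covering_number Z \<delta>)) / (- ln \<delta>) \<le> ln (1 / \<delta> + 1) / (- ln \<delta>)"
        using elim by (intro divide_right_mono) auto
      then show ?case by (simp only: ereal_less_eq)
    qed
  qed
  also have "\<dots> = 1"
  proof (rule lim_imp_Limsup)
    have "((\<lambda>\<delta>::real. ln (1 / \<delta> + 1) / (- ln \<delta>)) \<longlongrightarrow> 1) (at_right 0)" by real_asymp
    then show "((\<lambda>\<delta>. ereal (ln (1 / \<delta> + 1) / (- ln \<delta>))) \<longlongrightarrow> 1) (at_right 0)"
      by (simp add: one_ereal_def)
  qed simp
  finally show ?thesis .
qed

text \<open>Two points at distance at least twice the radius cannot share a covering ball, so
  assigning to each point the centre of a ball containing it is injective.\<close>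

lemma card_le_covering_number:
  fixes Z :: "circle set"
  assumes "0 < \<delta>" "S \<subseteq> Z" "\<And>x y. x \<in> S \<Longrightarrow> y \<in> S \<Longrightarrow> x \<noteq> y \<Longrightarrow> 2 * \<delta> \<le> dist x y"
  shows "card S \<le> covering_number Z \<delta>"
proof -
  obtain C0 :: "circle set" where "finite C0" "UNIV \<subseteq> (\<Union>x\<in>C0. ball x \<delta>)"
    by (rule circle_finite_cover[OF assms(1)])
  then obtain C where C: "finite C" "card C = covering_number Z \<delta>" "Z \<subseteq> (\<Union>x\<in>C. ball x \<delta>)"
    using covering_number_attained[of C0 Z \<delta>] order_trans[OF subset_UNIV, of _ Z] by metis
  have "\<exists>z\<in>C. dist z x < \<delta>" if "x \<in> S" for x
    using that assms(2) C(3) unfolding subset_iff UN_iff mem_ball by blast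
  then obtain h where h: "\<And>x. x \<in> S \<Longrightarrow> h x \<in> C \<and> dist (h x) x < \<delta>" by metis
  have "inj_on h S"
  proof (rule inj_onI, rule ccontr)
    fix x y assume xy: "x \<in> S" "y \<in> S" "h x = h y" "x \<noteq> y"
    have "dist x y < 2 * \<delta>"
      using dist_triangle3[of x y "h x"] h[of x] h[of y] xy by simp
    then show False using assms(3)[of x y] xy by simp
  qed
  then show ?thesis using card_inj_on_le[of h S C] h C(1,2) by auto
qed

lemma hausdorff_premeasure_finite_le:
  fixes Z :: "'a::metric_space set"
  assumes "finite S" "Z \<subseteq> (\<Union>x\<in>S. U x)" "0 < s" "0 \<le> d" "d \<le> \<delta>"
    and U: "\<And>x. x \<in> S \<Longrightarrow> bounded (U x) \<and> diameter (U x) \<le> d"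
  shows "hausdorff_premeasure s \<delta> Z \<le> ennreal (card S * d powr s)"
proof -
  obtain h where h: "bij_betw h {0..<card S} S"
    using ex_bij_betw_nat_finite[OF assms(1)] by blast
  then have hS: "h ` {0..<card S} = S" by (simp add: bij_betw_def)
  \<comment> \<open>The finite cover is padded to a sequence by empty sets, whose diameter is 0 and
    which contribute \<open>0 powr s = 0\<close>.\<close>
  define V where "V i = (if i < card S then U (h i) else {})" for i
  have V: "bounded (V i) \<and> diameter (V i) \<le> d" for i
  proof (cases "i < card S")
    case True
    then have "h i \<in> S" using hS by auto
    then show ?thesis using U True by (simp add: V_def)
  qed (use assms(4) in \<open>simp add: V_def\<close>)
  have "Z \<subseteq> (\<Union>i. V i)"
  proof
    fix z assume "z \<in> Z"
    then obtain x where "x \<in> S" "z \<in> U x" using assms(2) by blast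
    then obtain i where "i < card S" "x = h i" using hS by force
    then have "z \<in> V i" using \<open>z \<in> U x\<close> by (simp add: V_def)
    then show "z \<in> (\<Union>i. V i)" by blast
  qed
  then have "V \<in> {U. Z \<subseteq> (\<Union>i. U i) \<and> (\<forall>i. bounded (U i) \<and> diameter (U i) \<le> \<delta>)}"
    using V assms(5) order_trans by blast
  then have "hausdorff_premeasure s \<delta> Z \<le> (\<Sum>i. ennreal (diameter (V i) powr s))"
    unfolding hausdorff_premeasure_def by (rule INF_lower)
  also have "\<dots> = (\<Sum>i<card S. ennreal (diameter (V i) powr s))"
    by (rule suminf_finite) (auto simp: V_def)
  also have "\<dots> \<le> (\<Sum>i<card S. ennreal (d powr s))"
    using V assms(3) by (intro sum_mono ennreal_leI powr_mono2) (auto intro: diameter_ge_0)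
  also have "\<dots> = ennreal (card S * d powr s)"
    by (simp add: ennreal_mult ennreal_of_nat_eq_real_of_nat)
  finally show ?thesis .
qed

lemma diameter_cball_le:
  fixes x :: "'a::metric_space"
  assumes "0 \<le> r" shows "diameter (cball x r) \<le> 2 * r"
proof -
  have "dist y z \<le> 2 * r" if "y \<in> cball x r" "z \<in> cball x r" for y z
    using dist_triangle3[of y z x] that by simp
  then show ?thesis
    using assms unfolding diameter_def by (auto intro!: cSUP_least)
qed

section \<open>The Cantor set\<close>

context cantor_scheme
begin

lemma n_ge: "k \<le> n k"
proof (induction k)
  case (Suc k) then show ?case using n_less[of k] by simp
qed simp

lemma N_pos: "0 < N k"
  by (induction k) (simp_all add: N_0 N_Suc M_pos)

lemma a_pos: "0 < a k"
proof (cases k)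
  case (Suc j)
  have "0 < n (Suc j)" using n_less[of j] by simp
  then show ?thesis using N_pos[of "Suc j"] by (simp add: a_Suc Suc)
qed (simp add: a_0)

definition spacing :: "nat \<Rightarrow> real" where
  "spacing k = a k / M k"

lemma spacing_pos: "0 < spacing k"
  using a_pos M_pos by (simp add: spacing_def)

lemma a_Suc_le_spacing: "a (Suc k) \<le> spacing k"
  using gap[of k] lam_pos[of "Suc k"] a_pos[of "Suc k"] unfolding spacing_def by linarith

lemma spacing_le: "spacing k \<le> a k"
  using a_pos[of k] M_pos[of k] by (simp add: spacing_def field_simps)

lemma a_Suc_le: "a (Suc k) \<le> a k"
  using a_Suc_le_spacing[of k] spacing_le[of k] by linarith

lemma a_le_half: "a k \<le> 1 / 2"
  using lift_Suc_antimono_le[of a 0 k] a_Suc_le by (simp add: a_0)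

lemma a_le: "a k \<le> 1 / (real k * real (N k)) ^ 4" if "0 < k"
proof -
  obtain j where k: "k = Suc j" using \<open>0 < k\<close> by (cases k) auto
  show ?thesis
    unfolding k a_Suc using N_pos[of "Suc j"] n_ge[of "Suc j"]
    by (intro divide_left_mono power_mono mult_right_mono) auto
qed

lemma a_tendsto_0: "a \<longlonglongrightarrow> 0"
proof (rule tendsto_sandwich)
  show "\<forall>\<^sub>F k in sequentially. a k \<le> 1 / real k"
  proof (rule eventually_sequentiallyI)
    fix k :: nat assume k: "1 \<le> k"
    have *: "real k \<le> real k * real (N k)"
      using N_pos[of k] by (simp add: mult_le_cancel_left1)
    then have "1 \<le> real k * real (N k)" using k by linarith
    then have "real k * real (N k) \<le> (real k * real (N k)) ^ 4"
      by (rule self_le_power) simp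
    with * have "real k \<le> (real k * real (N k)) ^ 4" by linarith
    then have "1 / (real k * real (N k)) ^ 4 \<le> 1 / real k"
      using k by (intro divide_left_mono mult_pos_pos) linarith+
    then show "a k \<le> 1 / real k" using a_le[of k] k by linarith
  qed
  show "\<forall>\<^sub>F k in sequentially. 0 \<le> a k" using a_pos by (auto intro!: always_eventually less_imp_le)
  show "(\<lambda>k. 1 / real k) \<longlonglongrightarrow> 0" by real_asymp
qed simp

section \<open>The tree of pieces, represented by left endpoints\<close>

definition children :: "nat \<Rightarrow> real \<Rightarrow> real set" where
  "children k t = (\<lambda>j. t + real j * spacing k) ` {..<M k}"

text \<open>A left endpoint \<open>t\<close> of level \<open>k\<close> stands for the piece
  \<open>[t, t + a k]\<close>. Since \<open>a 0 = 1 / 2\<close>, the root is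
  \<open>[1/4, 3/4]\<close>: it avoids the cut of the circle, and it is short enough for distances
  on the circle to agree with those on the line.\<close>

primrec endpoints :: "nat \<Rightarrow> real set" where
  "endpoints 0 = {1 / 4}"
| "endpoints (Suc k) = (\<Union>t\<in>endpoints k. children k t)"

lemma finite_children: "finite (children k t)"
  by (simp add: children_def)

lemma card_children: "card (children k t) = M k"
  unfolding children_def using spacing_pos[of k] by (subst card_image) (auto simp: inj_on_def)

text \<open>The child with index 0 starts where its parent does, so left endpoints persist through
  all later levels.\<close>

lemma self_in_children: "t \<in> children k t"
  unfolding children_def using M_pos[of k] by (auto intro!: image_eqI[of _ _ 0])

lemma children_separated:
  assumes "u \<in> children k t" "v \<in> children k t" "u \<noteq> v"
  shows "spacing k \<le> \<bar>u - v\<bar>"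
proof -
  obtain i j :: nat where ij: "u = t + real i * spacing k" "v = t + real j * spacing k"
    using assms(1,2) unfolding children_def by auto
  have "1 \<le> \<bar>real i - real j\<bar>" using assms(3) ij by (cases i j rule: linorder_cases) auto
  then have "1 * spacing k \<le> \<bar>real i - real j\<bar> * spacing k"
    using spacing_pos[of k] by (intro mult_right_mono) auto
  also have "\<dots> = \<bar>u - v\<bar>"
    using spacing_pos[of k] ij by (simp add: abs_mult flip: left_diff_distrib)
  finally show ?thesis by simp
qed

text \<open>Pieces are nested: the last child starts one spacing before the end of its parent and is
  no longer than that spacing.\<close>

lemma children_bounds:
  assumes "u \<in> children k t"
  shows "t \<le> u" "u + a (Suc k) \<le> t + a k"
proof -
  obtain j :: nat where j: "j < M k" "u = t + real j * spacing k"
    using assms unfolding children_def by auto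
  show "t \<le> u" using j(2) spacing_pos[of k] by simp
  have "(real j + 1) * spacing k \<le> real (M k) * spacing k"
    using j(1) spacing_pos[of k] by (intro mult_right_mono) auto
  also have "\<dots> = a k" using M_pos[of k] by (simp add: spacing_def)
  finally show "u + a (Suc k) \<le> t + a k"
    using j(2) a_Suc_le_spacing[of k] by (simp add: algebra_simps)
qed

lemma finite_endpoints: "finite (endpoints k)"
  by (induction k) (simp_all add: finite_children)

lemma card_endpoints_le: "card (endpoints k) \<le> N k"
proof (induction k)
  case (Suc k)
  have "card (endpoints (Suc k)) \<le> (\<Sum>t\<in>endpoints k. card (children k t))"
    by (simp add: card_UN_le finite_endpoints)
  also have "\<dots> \<le> N k * M k" using Suc by (simp add: card_children)
  finally show ?case by (simp add: N_Suc)
qed (simp add: N_0)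

lemma endpoints_ancestor:
  "t \<in> endpoints (k + i) \<Longrightarrow> \<exists>u\<in>endpoints k. u \<le> t \<and> t + a (k + i) \<le> u + a k"
proof (induction i arbitrary: t)
  case (Suc i)
  then obtain v where v: "v \<in> endpoints (k + i)" "t \<in> children (k + i) v" by auto
  obtain u where "u \<in> endpoints k" "u \<le> v" "v + a (k + i) \<le> u + a k" using Suc.IH[OF v(1)] by blast
  then show ?case using children_bounds[OF v(2)] by (intro bexI[of _ u]) auto
qed auto

lemma endpoints_bounds:
  assumes "t \<in> endpoints k" shows "1 / 4 \<le> t" "t + a k \<le> 3 / 4"
  using endpoints_ancestor[of t 0 k] assms by (auto simp: a_0)

lemma endpoints_mono: "j \<le> k \<Longrightarrow> endpoints j \<subseteq> endpoints k"
  by (rule lift_Suc_mono_le[of endpoints]) (use self_in_children in auto)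

text \<open>An endpoint of an earlier level is still an endpoint at level \<open>k\<close>, and one
  of a later level has an ancestor there.\<close>

lemma endpoints_near:
  assumes "t \<in> endpoints j" shows "\<exists>u\<in>endpoints k. u \<le> t \<and> t \<le> u + a k"
proof (cases "j \<le> k")
  case True
  then show ?thesis using endpoints_mono[of j k] assms a_pos[of k] by (intro bexI[of _ t]) auto
next
  case False
  then obtain i where j: "j = k + i" by (metis le_add_diff_inverse nat_le_linear)
  obtain u where "u \<in> endpoints k" "u \<le> t" "t + a j \<le> u + a k"
    using endpoints_ancestor[of t k i] assms j by auto
  then show ?thesis using a_pos[of j] by (intro bexI[of _ u]) auto
qed

lemma dist_to_circle_endpoints:
  assumes "s \<in> endpoints j" "t \<in> endpoints k"
  shows "dist (to_circle s) (to_circle t) = \<bar>s - t\<bar>"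
proof (rule dist_to_circle_eq)
  show "\<bar>s - t\<bar> \<le> 1 / 2"
    using endpoints_bounds[OF assms(1)] endpoints_bounds[OF assms(2)] a_pos[of j] a_pos[of k] by linarith
qed

text \<open>Only a countable dense subset of the Cantor set, which is recovered as its closure. Both
  sets have the same distance function, so the density can be defined from this one.\<close>

definition cantor_pts :: "circle set" where
  "cantor_pts = to_circle ` (\<Union>k. endpoints k)"

lemma cantor_pts_nonempty: "cantor_pts \<noteq> {}"
  unfolding cantor_pts_def using endpoints.simps(1) by blast

lemma endpoints_in_cantor_pts: "t \<in> endpoints k \<Longrightarrow> to_circle t \<in> cantor_pts"
  unfolding cantor_pts_def by blast

section \<open>Dimensions of the Cantor set\<close>

lemma closure_cantor_pts_subset: "closure cantor_pts \<subseteq> (\<Union>u\<in>endpoints k. cball (to_circle u) (a k))"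
proof (rule closure_minimal)
  show "closed (\<Union>u\<in>endpoints k. cball (to_circle u) (a k))"
    using finite_endpoints by (intro closed_UN) auto
  show "cantor_pts \<subseteq> (\<Union>u\<in>endpoints k. cball (to_circle u) (a k))"
  proof
    fix x assume "x \<in> cantor_pts"
    then obtain t j where t: "t \<in> endpoints j" "x = to_circle t" unfolding cantor_pts_def by blast
    obtain u where u: "u \<in> endpoints k" "u \<le> t" "t \<le> u + a k" using endpoints_near[OF t(1)] by blast
    have "x \<in> cball (to_circle u) (a k)"
      using u dist_to_circle_endpoints[OF u(1) t(1)] by (simp add: t(2))
    then show "x \<in> (\<Union>u\<in>endpoints k. cball (to_circle u) (a k))" using u(1) by blast
  qed
qed

text \<open>Here the fourth power in \<open>a_Suc\<close> pays off: the square root of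
  \<open>2 * a k\<close> is at most \<open>2 / (k * N k)\<^sup>2\<close>, so the at most
  \<open>N k\<close> balls of level \<open>k\<close> contribute at most \<open>2 / k\<close> to the
  premeasure of exponent \<open>1 / 2\<close>.\<close>

lemma hausdorff_dim_closure_cantor_pts: "hausdorff_dim (closure cantor_pts) \<le> ereal (1 / 2)"
proof -
  have "hausdorff_premeasure (1 / 2) \<delta> (closure cantor_pts) \<le> 0" if \<delta>: "0 < \<delta>" for \<delta>
  proof (rule LIMSEQ_le_const)
    show "(\<lambda>k. ennreal (2 / real k)) \<longlonglongrightarrow> 0"
      unfolding ennreal_0[symmetric] by (intro tendsto_ennrealI) real_asymp
    have "(\<lambda>k. 2 * a k) \<longlonglongrightarrow> 2 * 0" by (intro tendsto_intros a_tendsto_0)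
    then have "\<forall>\<^sub>F k in sequentially. 2 * a k < \<delta>" using \<delta> by (intro order_tendstoD) auto
    then have "\<forall>\<^sub>F k in sequentially. hausdorff_premeasure (1 / 2) \<delta> (closure cantor_pts) \<le> ennreal (2 / real k)"
      using eventually_gt_at_top[of 0]
    proof eventually_elim
      case (elim k)
      have "hausdorff_premeasure (1 / 2) \<delta> (closure cantor_pts)
          \<le> ennreal (card (endpoints k) * (2 * a k) powr (1 / 2))"
      proof (rule hausdorff_premeasure_finite_le[OF finite_endpoints closure_cantor_pts_subset])
        fix x
        have "diameter (cball (to_circle x) (a k)) \<le> 2 * a k"
          using a_pos[of k] by (intro diameter_cball_le) simp
        then show "bounded (cball (to_circle x) (a k)) \<and> diameter (cball (to_circle x) (a k)) \<le> 2 * a k"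
          by simp
      qed (use elim a_pos[of k] in auto)
      also have "\<dots> \<le> ennreal (2 / real k)"
      proof (rule ennreal_leI)
        define x where "x = real k * real (N k)"
        have x: "real k \<le> x" "real (N k) \<le> x" "0 < x"
          using elim N_pos[of k] unfolding x_def by (auto simp: mult_le_cancel_left1 mult_le_cancel_right1)
        have "(2 * a k) powr (1 / 2) \<le> (2 / x ^ 4) powr (1 / 2)"
          using a_le[of k] a_pos[of k] elim unfolding x_def by (intro powr_mono2) auto
        also have "\<dots> = sqrt 2 / x\<^sup>2"
          using x real_sqrt_power_even[of 4 x] by (simp add: powr_half_sqrt real_sqrt_divide real_sqrt_power)
        also have "\<dots> \<le> 2 / x\<^sup>2"
          using x sqrt2_less_2 by (intro divide_right_mono) auto
        finally have "card (endpoints k) * (2 * a k) powr (1 / 2) \<le> N k * (2 / x\<^sup>2)"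
          using card_endpoints_le[of k] by (intro mult_mono) auto
        also have "\<dots> = 2 / (real k * x)"
          using N_pos[of k] elim by (simp add: x_def power2_eq_square field_simps)
        also have "\<dots> \<le> 2 / (real k * 1)"
          using x elim by (intro divide_left_mono mult_left_mono) auto
        finally show "card (endpoints k) * (2 * a k) powr (1 / 2) \<le> 2 / real k" by simp
      qed
      finally show ?case .
    qed
    then show "\<exists>K. \<forall>k\<ge>K. hausdorff_premeasure (1 / 2) \<delta> (closure cantor_pts) \<le> ennreal (2 / real k)"
      by (simp add: eventually_sequentially)
  qed
  then have "hausdorff_outer (1 / 2) (closure cantor_pts) = 0"
    unfolding hausdorff_outer_def by (intro antisym SUP_least) auto
  then show ?thesis unfolding hausdorff_dim_def by (intro INF_lower) simp
qed

text \<open>The children of the leftmost piece suffice: they are \<open>M k\<close> points at mutual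
  distance at least \<open>spacing k\<close>, so the covering number at radius
  \<open>spacing k / 2\<close> is at least \<open>M k\<close>, and \<open>box\<close> compares the
  logarithms.\<close>

lemma upper_box_dim_closure_cantor_pts: "upper_box_dim (closure cantor_pts) = 1"
proof (rule antisym[OF upper_box_dim_circle_le])
  let ?X = "\<lambda>\<delta>. ereal (ln (real (covering_number (closure cantor_pts) \<delta>)) / (- ln \<delta>))"
  have X_ge: "ereal (1 - 1 / (real k + 2)) \<le> ?X (spacing k / 2)" for k
  proof -
    have t0: "1 / 4 \<in> endpoints k" using endpoints_mono[of 0 k] by simp
    have sub: "children k (1 / 4) \<subseteq> endpoints (Suc k)" using t0 by auto
    have dist: "dist (to_circle u) (to_circle v) = \<bar>u - v\<bar>"
      if "u \<in> children k (1 / 4)" "v \<in> children k (1 / 4)" for u v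
      using dist_to_circle_endpoints sub that by blast
    have "inj_on to_circle (children k (1 / 4))"
    proof (rule inj_onI)
      fix u v assume uv: "u \<in> children k (1 / 4)" "v \<in> children k (1 / 4)" "to_circle u = to_circle v"
      then have "\<bar>u - v\<bar> = 0" using dist[OF uv(1,2)] by simp
      then show "u = v" by simp
    qed
    then have "card (to_circle ` children k (1 / 4)) = M k"
      by (simp add: card_image card_children)
    moreover have "card (to_circle ` children k (1 / 4)) \<le> covering_number (closure cantor_pts) (spacing k / 2)"
    proof (rule card_le_covering_number)
      show "to_circle ` children k (1 / 4) \<subseteq> closure cantor_pts"
        using sub endpoints_in_cantor_pts closure_subset by blast
      fix x y assume "x \<in> to_circle ` children k (1 / 4)" "y \<in> to_circle ` children k (1 / 4)" "x \<noteq> y"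
      then show "2 * (spacing k / 2) \<le> dist x y"
        using children_separated[of _ k "1 / 4"] dist by fastforce
    qed (use spacing_pos[of k] in simp)
    ultimately have "ln (M k) \<le> ln (covering_number (closure cantor_pts) (spacing k / 2))"
      using M_pos[of k] by simp
    then have "(1 - 1 / (real k + 2)) * ln (2 * M k / a k) \<le> ln (covering_number (closure cantor_pts) (spacing k / 2))"
      using box[of k] by linarith
    moreover have "- ln (spacing k / 2) = ln (2 * M k / a k)"
      using a_pos[of k] M_pos[of k] by (simp add: spacing_def ln_div ln_mult)
    moreover have "1 < 2 * M k / a k"
      using a_pos[of k] a_le_half[of k] M_pos[of k] by (simp add: field_simps)
    ultimately show ?thesis by (simp add: pos_le_divide_eq)
  qed
  have "spacing \<longlonglongrightarrow> 0"
    by (rule tendsto_sandwich[OF _ _ tendsto_const a_tendsto_0])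
      (use spacing_pos spacing_le in \<open>auto intro!: always_eventually less_imp_le\<close>)
  then have "(\<lambda>k. spacing k / 2) \<longlonglongrightarrow> 0 / 2" by (intro tendsto_intros) auto
  then have lim: "filterlim (\<lambda>k. spacing k / 2) (at_right 0) sequentially"
    using spacing_pos spacing_pos[THEN less_imp_neq, symmetric]
    by (auto simp: filterlim_at intro!: always_eventually)
  show "1 \<le> upper_box_dim (closure cantor_pts)"
    unfolding upper_box_dim_def
  proof (rule Limsup_greatest)
    \<comment> \<open>Any property valid near 0 on the right eventually holds at the radii
      \<open>spacing k / 2\<close>, so its supremum is at least the limit 1 of the lower
      bounds.\<close>
    fix P assume "eventually P (at_right (0 :: real))"
    then have "\<forall>\<^sub>F k in sequentially. P (spacing k / 2)"
      using lim unfolding filterlim_iff by blast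
    then have "\<forall>\<^sub>F k in sequentially. ereal (1 - 1 / (real k + 2)) \<le> (SUP \<delta>\<in>Collect P. ?X \<delta>)"
    proof eventually_elim
      case (elim k)
      then show ?case by (intro order_trans[OF X_ge] SUP_upper) simp
    qed
    moreover have "(\<lambda>k. ereal (1 - 1 / (real k + 2))) \<longlonglongrightarrow> 1"
      unfolding one_ereal_def by (intro tendsto_ereal) real_asymp
    ultimately show "1 \<le> (SUP \<delta>\<in>Collect P. ?X \<delta>)" by (intro tendsto_upperbound) auto
  qed
qed

end

section \<open>The density and the random covering\<close>

text \<open>Rounding to the nearest integer shows that the circle has diameter at most
  \<open>1 / 2\<close>; this keeps \<open>base_level\<close> at least \<open>1 / 2\<close>.\<close>

lemma infdist_circle_le_half: "infdist (x :: circle) A \<le> 1 / 2"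
proof (cases "A = {}")
  case False
  then obtain a where a: "a \<in> A" by blast
  have "dist x a \<le> 1 / 2"
  proof (induct x rule: circle.abs_induct, induct a rule: circle.abs_induct)
    case (1 u v)
    have "infdist (v - u) \<int> \<le> \<bar>v - u - of_int (round (v - u))\<bar>"
      by (rule infdist_Ints_le) simp
    also have "\<dots> \<le> 1 / 2" using of_int_round_abs_le[of "v - u"] by (simp add: abs_minus_commute)
    finally show ?case by (simp add: dist_to_circle)
  qed
  then show ?thesis using infdist_le[OF a, of x] by linarith
qed (simp add: infdist_def)

context cantor_scheme
begin

definition base_level :: real where
  "base_level = 1 - (\<integral>x. infdist x cantor_pts \<partial>circle_lebesgue)"

definition dens :: "circle \<Rightarrow> real" where
  "dens x = base_level + infdist x cantor_pts"

lemma continuous_infdist_cantor_pts: "continuous_on UNIV (\<lambda>x. infdist x cantor_pts)"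
  by (intro continuous_intros)

lemma infdist_cantor_pts_measurable [measurable]: "(\<lambda>x. infdist x cantor_pts) \<in> borel_measurable borel"
  by (rule borel_measurable_continuous_onI[OF continuous_infdist_cantor_pts])

lemma integrable_infdist_cantor_pts: "integrable circle_lebesgue (\<lambda>x. infdist x cantor_pts)"
proof (rule circle_lebesgue.integrable_const_bound[where B = "1 / 2"])
  show "AE x in circle_lebesgue. norm (infdist x cantor_pts) \<le> 1 / 2"
    using infdist_circle_le_half by (intro AE_I2) (simp only: real_norm_def abs_of_nonneg infdist_nonneg)
qed simp

lemma base_level_bounds: "1 / 2 \<le> base_level" "base_level \<le> 1"
proof -
  have "(\<integral>x. infdist x cantor_pts \<partial>circle_lebesgue) \<le> (\<integral>x. 1 / 2 \<partial>circle_lebesgue)"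
    by (intro integral_mono integrable_infdist_cantor_pts infdist_circle_le_half) simp
  then show "1 / 2 \<le> base_level" by (simp add: base_level_def measure_circle_lebesgue_UNIV)
  have "0 \<le> (\<integral>x. infdist x cantor_pts \<partial>circle_lebesgue)" by (simp add: infdist_nonneg)
  then show "base_level \<le> 1" by (simp add: base_level_def)
qed

lemma dens_nonneg: "0 \<le> dens x"
  unfolding dens_def using base_level_bounds(1) infdist_nonneg[of x cantor_pts] by linarith

lemma dens_measurable [measurable]: "dens \<in> borel_measurable borel"
  unfolding dens_def[abs_def] by measurable

lemma prob_density_dens: "prob_density dens"
  unfolding prob_density_def using dens_nonneg integrable_infdist_cantor_pts
  by (simp add: dens_def[abs_def] base_level_def measure_circle_lebesgue_UNIV)

lemma min_level_dens: "min_level dens = base_level"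
  using min_level_add_infdist[OF cantor_pts_nonempty] by (simp add: dens_def[abs_def])

lemma min_set_dens: "min_set dens = closure cantor_pts"
  using min_set_add_infdist[OF cantor_pts_nonempty] by (simp add: dens_def[abs_def])

lemma sets_density_measure [simp]: "sets (density_measure dens) = sets borel"
  by (simp add: density_measure_def)

lemma prob_space_density_measure: "prob_space (density_measure dens)"
proof
  have "emeasure (density_measure dens) UNIV = (\<integral>\<^sup>+x. ennreal (dens x) \<partial>circle_lebesgue)"
    by (simp add: density_measure_def emeasure_density)
  also have "\<dots> = ennreal (\<integral>x. dens x \<partial>circle_lebesgue)"
    using prob_density_dens by (intro nn_integral_eq_integral) (auto simp: prob_density_def)
  finally show "emeasure (density_measure dens) (space (density_measure dens)) = 1"
    using prob_density_dens by (simp add: prob_density_def density_measure_def)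
qed

text \<open>The centre lies in \<open>cantor_pts\<close>, so inside the ball the density exceeds its
  minimum by at most \<open>r\<close>.\<close>

lemma measure_density_ball_le:
  assumes "t \<in> endpoints k" "0 \<le> r" "r \<le> 1 / 4"
  shows "measure (density_measure dens) (ball (to_circle t) r) \<le> (base_level + r) * (2 * r)"
proof -
  interpret \<mu>: prob_space "density_measure dens" by (rule prob_space_density_measure)
  let ?B = "ball (to_circle t) r"
  have t: "1 / 4 \<le> t" "t \<le> 3 / 4"
    using endpoints_bounds[OF assms(1)] a_pos[of k] by auto
  have le: "dens x \<le> base_level + r" if "x \<in> ?B" for x
    using infdist_le[OF endpoints_in_cantor_pts[OF assms(1)], of x] that
    by (simp add: dens_def dist_commute)
  have "emeasure (density_measure dens) ?B = (\<integral>\<^sup>+x. ennreal (dens x) * indicator ?B x \<partial>circle_lebesgue)"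
    by (simp add: density_measure_def emeasure_density)
  also have "\<dots> \<le> (\<integral>\<^sup>+x. ennreal (base_level + r) * indicator ?B x \<partial>circle_lebesgue)"
    using le by (intro nn_integral_mono) (auto simp: indicator_def intro!: ennreal_leI)
  also have "\<dots> = ennreal (base_level + r) * emeasure circle_lebesgue ?B"
    by (subst nn_integral_cmult_indicator) auto
  also have "\<dots> \<le> ennreal (base_level + r) * ennreal (2 * r)"
    using measure_circle_lebesgue_ball_le[OF t assms(2,3)]
    by (intro mult_left_mono) (auto simp: circle_lebesgue.emeasure_eq_measure intro!: ennreal_leI)
  also have "\<dots> = ennreal ((base_level + r) * (2 * r))"
    using assms base_level_bounds by (subst ennreal_mult) auto
  finally show ?thesis
    using assms base_level_bounds by (simp add: \<mu>.emeasure_eq_measure)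
qed

section \<open>The arc lengths\<close>

text \<open>The least \<open>k\<close> exists because \<open>i \<le> n i\<close>. Since
  \<open>n 0 = 0\<close>, block 0 contains only the index 0, and the indices in
  \<open>{n k<..n (Suc k)}\<close> form block \<open>Suc k\<close>.\<close>

definition block :: "nat \<Rightarrow> nat" where
  "block i = (LEAST k. i \<le> n k)"

definition len :: "nat \<Rightarrow> real" where
  "len i = lam (block i) / base_level"

lemma block_le: "i \<le> n k \<Longrightarrow> block i \<le> k"
  unfolding block_def by (rule Least_le)

lemma le_n_block: "i \<le> n (block i)"
  unfolding block_def by (rule LeastI[of _ i]) (rule n_ge)

lemma blockE:
  assumes "1 \<le> i" obtains k where "i \<in> {n k<..n (Suc k)}" "block i = Suc k"
proof -
  have "block i \<noteq> 0" using le_n_block[of i] assms n_0 by (metis not_one_le_zero le_zero_eq order_trans)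
  then obtain k where k: "block i = Suc k" by (cases "block i") auto
  have "\<not> i \<le> n k" using block_le[of i k] k by auto
  then show thesis using that[of k] k le_n_block[of i] by auto
qed

lemma lam_antimono: "j \<le> k \<Longrightarrow> lam k \<le> lam j"
  by (rule lift_Suc_antimono_le[of lam]) (simp_all add: lam_less less_imp_le)

lemma len_antimono: "i \<le> j \<Longrightarrow> len j \<le> len i"
proof -
  assume "i \<le> j"
  then have "block i \<le> block j" by (intro block_le order_trans[OF _ le_n_block])
  then show ?thesis
    unfolding len_def using base_level_bounds by (intro divide_right_mono lam_antimono) auto
qed

lemma len_bounds:
  assumes "1 \<le> i" shows "0 < len i" "len i < 1"
proof -
  obtain k where k: "block i = Suc k" by (rule blockE[OF assms])
  have "lam (Suc k) < 1 / 2" using lam_less[of k] lam_antimono[of 0 k] by (simp add: lam_0)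
  then show "len i < 1" "0 < len i"
    unfolding len_def k using base_level_bounds lam_pos[of "Suc k"] by (simp_all add: field_simps)
qed

text \<open>Arcs of earlier blocks are at least as long as those of the current one, so each of the
  \<open>n (Suc k)\<close> terms is at least \<open>lam (Suc k) / base_level\<close>;
  \<open>lam_ge\<close> does the rest.\<close>

lemma sum_len_ge:
  "(1 - 1 / (real k + 2)) * ln (n (Suc k)) / base_level \<le> (\<Sum>i = 1..n (Suc k). len i)"
proof -
  have "(1 - 1 / (real k + 2)) * ln (n (Suc k)) / base_level \<le> n (Suc k) * lam (Suc k) / base_level"
    using lam_ge[of k] base_level_bounds by (intro divide_right_mono) auto
  also have "\<dots> = (\<Sum>i = 1..n (Suc k). lam (Suc k) / base_level)" by simp
  also have "\<dots> \<le> (\<Sum>i = 1..n (Suc k). len i)"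
    unfolding len_def using base_level_bounds
    by (intro sum_mono divide_right_mono lam_antimono block_le) auto
  finally show ?thesis .
qed

lemma limsup_len:
  "ereal (1 / base_level) \<le> limsup (\<lambda>j. ereal ((\<Sum>i = 1..j. len i) / ln (real j)))"
proof -
  let ?X = "\<lambda>j. ereal ((\<Sum>i = 1..j. len i) / ln (real j))"
  have "(\<lambda>k. ereal ((1 - 1 / (real k + 2)) / base_level)) \<longlonglongrightarrow> ereal (1 / base_level)"
    using base_level_bounds by (intro tendsto_ereal tendsto_divide tendsto_const) (real_asymp | simp)+
  then have "ereal (1 / base_level) = limsup (\<lambda>k. ereal ((1 - 1 / (real k + 2)) / base_level))"
    by (rule lim_imp_Limsup[OF trivial_limit_sequentially, symmetric])
  also have "\<dots> \<le> limsup (?X \<circ> (\<lambda>k. n (Suc k)))"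
  proof (intro Limsup_mono eventually_sequentiallyI)
    \<comment> \<open>For \<open>k = 0\<close> the index \<open>n (Suc k)\<close> might be 1, and
      then the logarithm in the denominator would vanish.\<close>
    fix k :: nat assume "1 \<le> k"
    then have "1 < n (Suc k)" using n_ge[of "Suc k"] by simp
    then have "0 < ln (n (Suc k))" by simp
    then show "ereal ((1 - 1 / (real k + 2)) / base_level) \<le> (?X \<circ> (\<lambda>k. n (Suc k))) k"
      using sum_len_ge[of k] base_level_bounds by (simp add: field_simps)
  qed
  also have "\<dots> \<le> limsup ?X"
    by (rule limsup_subseq_mono) (simp add: strict_mono_Suc_iff n_less)
  finally show ?thesis .
qed

section \<open>Missed pieces and the uncovered point\<close>

text \<open>Half the arc length of block \<open>Suc k\<close> plus the length of a child: an arc of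
  that block that meets the child starting at \<open>u\<close> has its centre within this distance
  of \<open>u\<close>.\<close>

definition radius :: "nat \<Rightarrow> real" where
  "radius k = lam (Suc k) / (2 * base_level) + a (Suc k)"

lemma radius_bounds: "0 \<le> radius k" "radius k \<le> lam (Suc k) + a (Suc k)"
  using base_level_bounds lam_pos[of "Suc k"] a_pos[of "Suc k"]
  unfolding radius_def by (auto simp: field_simps)

abbreviation samples :: "(nat \<Rightarrow> circle) measure" where
  "samples \<equiv> Pi\<^sub>M UNIV (\<lambda>_. density_measure dens)"

text \<open>Declared for every piece \<open>t\<close>, whether or not its ancestors are missed, so
  that a union bound over pieces and levels suffices.\<close>

definition blocked :: "nat \<Rightarrow> real \<Rightarrow> (nat \<Rightarrow> circle) set" where
  "blocked k t = {\<omega> \<in> space samples.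
     \<forall>u\<in>children k t. \<exists>i\<in>{n k<..n (Suc k)}. \<omega> i \<in> ball (to_circle u) (radius k)}"

lemma space_samples: "space samples = UNIV"
  by (simp add: space_PiM density_measure_def)

lemma blocked_sets [measurable]: "blocked k t \<in> sets samples"
proof -
  have [measurable]: "ball (to_circle u) (radius k) \<in> sets (density_measure dens)" for u by simp
  show ?thesis unfolding blocked_def using finite_children by measurable
qed

text \<open>An instance of \<open>prob_all_hit_le\<close> for the balls around the children:
  \<open>gap\<close> makes them disjoint, \<open>p\<close> bounds their measure, and
  \<open>miss\<close> bounds the expected number of missed children from below.\<close>

lemma prob_blocked_le:
  assumes "t \<in> endpoints k"
  shows "N k * measure samples (blocked k t) \<le> (1 / 2) ^ (k + 2)"
proof -
  define p where "p = lam (Suc k) + 2 * a (Suc k) + 2 * (lam (Suc k) + a (Suc k))\<^sup>2"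
  have p: "p \<le> 1" "0 \<le> p"
    unfolding p_def using hit_le_1[of k] lam_pos[of "Suc k"] a_pos[of "Suc k"] by auto
  have gap': "2 * radius k \<le> spacing k"
    using gap[of k] radius_bounds(2)[of k] unfolding spacing_def by linarith
  then have r4: "radius k \<le> 1 / 4"
    using spacing_le[of k] a_le_half[of k] by linarith
  have child: "u \<in> endpoints (Suc k)" if "u \<in> children k t" for u
    using that assms by auto
  let ?x = "measure samples (blocked k t)"
  have "real (card (children k t)) * (1 - p) ^ card {n k<..n (Suc k)} * ?x \<le> 1"
    unfolding blocked_def
  proof (rule prob_all_hit_le[OF prob_space_density_measure _ finite_children])
    show "disjoint_family_on (\<lambda>u. ball (to_circle u) (radius k)) (children k t)"
    unfolding disjoint_family_on_def
    proof (intro ballI impI)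
      fix u v assume uv: "u \<in> children k t" "v \<in> children k t" "u \<noteq> v"
      have "2 * radius k \<le> dist (to_circle u) (to_circle v)"
        using children_separated[OF uv] gap' dist_to_circle_endpoints[OF child[OF uv(1)] child[OF uv(2)]]
        by linarith
      then show "ball (to_circle u) (radius k) \<inter> ball (to_circle v) (radius k) = {}"
        by (intro disjoint_ballI) simp
    qed
    fix u assume "u \<in> children k t"
    then have "measure (density_measure dens) (ball (to_circle u) (radius k))
        \<le> (base_level + radius k) * (2 * radius k)"
      by (intro measure_density_ball_le[OF child] radius_bounds r4)
    \<comment> \<open>The factor \<open>base_level\<close> cancels against the one in
      \<open>len\<close>, which leaves \<open>lam (Suc k)\<close> as the main term.\<close>
    also have "\<dots> = lam (Suc k) + 2 * base_level * a (Suc k) + 2 * (radius k)\<^sup>2"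
      using base_level_bounds(1) by (simp add: radius_def field_simps power2_eq_square)
    also have "\<dots> \<le> p"
      unfolding p_def using base_level_bounds a_pos[of "Suc k"] radius_bounds[of k]
      by (intro add_mono mult_mono power_mono) auto
    finally show "measure (density_measure dens) (ball (to_circle u) (radius k)) \<le> p" .
  qed (use p in auto)
  then have *: "M k * (1 - p) ^ (n (Suc k) - n k) * ?x \<le> 1" by (simp add: card_children)
  have "real (N k) * 2 ^ (k + 2) \<le> M k * (1 - p) ^ n (Suc k)" using miss[of k] by (simp add: p_def)
  \<comment> \<open>The block has \<open>n (Suc k) - n k\<close> indices; \<open>miss\<close> uses
    the larger exponent \<open>n (Suc k)\<close>, which only makes the power smaller.\<close>
  also have "\<dots> \<le> M k * (1 - p) ^ (n (Suc k) - n k)"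
    using p by (intro mult_left_mono power_decreasing) auto
  finally have "real (N k) * 2 ^ (k + 2) * ?x \<le> M k * (1 - p) ^ (n (Suc k) - n k) * ?x"
    by (intro mult_right_mono) auto
  with * have "(N k * ?x) * 2 ^ (k + 2) \<le> 1" by (simp add: mult_ac)
  then show ?thesis by (simp add: field_simps)
qed

text \<open>Level \<open>k\<close> has at most \<open>N k\<close> pieces and so contributes at most
  \<open>(1 / 2) ^ (k + 2)\<close>; these bounds sum to \<open>1 / 2\<close>.\<close>

lemma prob_some_blocked_le: "measure samples (\<Union>k. \<Union>t\<in>endpoints k. blocked k t) \<le> 1 / 2"
proof -
  interpret \<mu>: prob_space "density_measure dens" by (rule prob_space_density_measure)
  interpret W: product_prob_space "\<lambda>_ :: nat. density_measure dens" UNIV ..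
  have le: "measure samples (\<Union>t\<in>endpoints k. blocked k t) \<le> (1 / 2) ^ (k + 2)" for k
  proof -
    have "measure samples (\<Union>t\<in>endpoints k. blocked k t) \<le> (\<Sum>t\<in>endpoints k. measure samples (blocked k t))"
      by (intro W.finite_measure_subadditive_finite finite_endpoints) auto
    also have "\<dots> \<le> (\<Sum>t\<in>endpoints k. (1 / 2) ^ (k + 2) / N k)"
      using prob_blocked_le[of _ k] N_pos[of k] by (intro sum_mono) (simp add: field_simps)
    also have "\<dots> = card (endpoints k) / N k * (1 / 2) ^ (k + 2)" by simp
    also have "\<dots> \<le> 1 * (1 / 2) ^ (k + 2)"
      using card_endpoints_le[of k] N_pos[of k] by (intro mult_right_mono) auto
    finally show ?thesis by simp
  qed
  have geo: "(\<lambda>k. (1 / 2 :: real) ^ (k + 2)) sums (1 / 2)"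
    using sums_mult[OF geometric_sums[of "1 / 2 :: real"], of "1 / 4"] by (simp add: power_add)
  have summ: "summable (\<lambda>k. measure samples (\<Union>t\<in>endpoints k. blocked k t))"
    using le by (intro summable_comparison_test'[OF sums_summable[OF geo], of 0]) simp
  have "measure samples (\<Union>k. \<Union>t\<in>endpoints k. blocked k t)
      \<le> (\<Sum>k. measure samples (\<Union>t\<in>endpoints k. blocked k t))"
    using finite_endpoints summ
    by (intro W.finite_measure_subadditive_countably) (auto intro!: sets.finite_UN)
  also have "\<dots> \<le> (\<Sum>k. (1 / 2) ^ (k + 2))"
    using le summ sums_summable[OF geo] by (intro suminf_le) auto
  also have "\<dots> = 1 / 2" using geo by (rule sums_unique[symmetric])
  finally show ?thesis .
qed

text \<open>If no piece is blocked, missed children can be chosen level by level. Their left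
  endpoints increase to a point \<open>x\<close> lying in all chosen pieces, and an arc of block
  \<open>Suc k\<close> containing \<open>x\<close> would have its centre within
  \<open>radius k\<close> of the chosen child's endpoint.\<close>

lemma uncovered_point:
  assumes "\<omega> \<notin> (\<Union>k. \<Union>t\<in>endpoints k. blocked k t)"
  shows "\<exists>x. \<forall>i\<ge>1. x \<notin> open_arc (\<omega> i) (len i)"
proof -
  define free where "free k u \<longleftrightarrow> (\<forall>i\<in>{n k<..n (Suc k)}. \<omega> i \<notin> ball (to_circle u) (radius k))" for k u
  have step: "\<exists>u. u \<in> endpoints (Suc k) \<and> (u \<in> children k t \<and> free k u)" if "t \<in> endpoints k" for k t
  proof -
    have "\<omega> \<notin> blocked k t" using assms that by blast
    then obtain u where "u \<in> children k t" "free k u"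
      unfolding blocked_def free_def space_samples by blast
    then show ?thesis using that by auto
  qed
  have "\<exists>t. \<forall>k. t k \<in> endpoints k \<and> (t (Suc k) \<in> children k (t k) \<and> free k (t (Suc k)))"
  proof (rule dependent_nat_choice)
    show "\<exists>t. t \<in> endpoints 0" by (rule exI[of _ "1 / 4"]) simp
  qed (use step in blast)
  then obtain t where t: "\<And>k. t k \<in> endpoints k" "\<And>k. t (Suc k) \<in> children k (t k)"
      "\<And>k. free k (t (Suc k))" by blast
  have inc: "incseq t" using children_bounds(1)[OF t(2)] by (intro incseq_SucI) auto
  have dec: "decseq (\<lambda>k. t k + a k)" using children_bounds(2)[OF t(2)] by (intro decseq_SucI) auto
  have "t k \<le> 1" for k using endpoints_bounds(2)[OF t(1)[of k]] a_pos[of k] by linarith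
  then obtain x where x: "t \<longlonglongrightarrow> x" "\<And>k. t k \<le> x" using incseq_convergent[OF inc] by metis
  have x_le: "x \<le> t k + a k" for k
  proof (rule LIMSEQ_le_const2[OF x(1)], intro exI[of _ k] allI impI)
    fix j assume "k \<le> j"
    then show "t j \<le> t k + a k" using decseqD[OF dec, of k j] a_pos[of j] by linarith
  qed
  show ?thesis
  proof (intro exI[of _ "to_circle x"] allI impI)
    fix i :: nat assume "1 \<le> i"
    then obtain k where k: "i \<in> {n k<..n (Suc k)}" "block i = Suc k" by (rule blockE)
    have "\<not> dist (to_circle (t (Suc k))) (\<omega> i) < radius k"
      using t(3)[of k] k(1) unfolding free_def by auto
    moreover have "dist (to_circle (t (Suc k))) (to_circle x) \<le> a (Suc k)"
      using dist_to_circle_le[of "t (Suc k)" x] x(2)[of "Suc k"] x_le[of "Suc k"]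
      by (simp add: dist_real_def)
    moreover have "dist (to_circle (t (Suc k))) (\<omega> i)
        \<le> dist (to_circle (t (Suc k))) (to_circle x) + dist (\<omega> i) (to_circle x)"
      by (rule dist_triangle2)
    moreover have "len i / 2 = radius k - a (Suc k)" by (simp add: len_def k(2) radius_def)
    ultimately show "to_circle x \<notin> open_arc (\<omega> i) (len i)"
      by (simp add: open_arc_eq_ball)
  qed
qed

text \<open>Almost sure covering would force almost every sample sequence into the union of the
  \<open>blocked\<close> events, whose probability is at most \<open>1 / 2\<close>.\<close>

lemma not_dvoretzky_covered: "\<not> dvoretzky_covered dens len"
proof
  interpret \<mu>: prob_space "density_measure dens" by (rule prob_space_density_measure)
  interpret W: product_prob_space "\<lambda>_ :: nat. density_measure dens" UNIV ..
  let ?B = "\<Union>k. \<Union>t\<in>endpoints k. blocked k t"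
  assume "dvoretzky_covered dens len"
  then have "AE \<omega> in samples. \<forall>x. \<exists>\<^sub>\<infinity>i. x \<in> open_arc (\<omega> i) (len i)"
    by (simp add: dvoretzky_covered_def limsup_open_arc_eq_UNIV_iff)
  then have "AE \<omega> in samples. \<omega> \<in> ?B"
  proof eventually_elim
    case (elim \<omega>)
    show ?case
    proof (rule ccontr)
      assume "\<omega> \<notin> ?B"
      then obtain x where "\<forall>i\<ge>1. x \<notin> open_arc (\<omega> i) (len i)"
        using uncovered_point by blast
      \<comment> \<open>Being covered infinitely often supplies an index \<open>i\<close> other than
        0, the only one that \<open>uncovered_point\<close> leaves out.\<close>
      moreover obtain i where "1 \<le> i" "x \<in> open_arc (\<omega> i) (len i)"
        using elim unfolding INFM_nat_le by blast
      ultimately show False by blast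
    qed
  qed
  moreover have "?B \<in> sets samples"
    using finite_endpoints by (intro sets.countable_UN sets.finite_UN) (auto intro!: sets.finite_UN)
  ultimately have "measure samples ?B = 1" by (simp add: W.prob_eq_1)
  then show False using prob_some_blocked_le by simp
qed

end

theorem theorem1p2:
  shows "\<exists>(f :: circle \<Rightarrow> real) (l :: nat \<Rightarrow> real).
     prob_density f \<and> 0 < min_level f \<and>
     hausdorff_dim (min_set f) < upper_box_dim (min_set f) \<and> upper_box_dim (min_set f) = 1 \<and>
     antimono_on {1..} l \<and> (\<forall>n\<ge>1. 0 < l n \<and> l n < 1) \<and>
     limsup (\<lambda>n. ereal ((\<Sum>i = 1..n. l i) / ln (real n))) \<ge> ereal (1 / min_level f) \<and>
     \<not> dvoretzky_covered f l"
proof -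
  obtain n M N a lam where "cantor_scheme n M N a lam" using cantor_scheme_exists by blast
  then interpret cantor_scheme n M N a lam .
  have "hausdorff_dim (closure cantor_pts) < 1"
    using hausdorff_dim_closure_cantor_pts by (rule le_less_trans) (simp add: one_ereal_def)
  moreover have "antimono_on {1..} len" by (rule monotone_onI) (rule len_antimono)
  ultimately show ?thesis
    using prob_density_dens base_level_bounds upper_box_dim_closure_cantor_pts len_bounds limsup_len
      not_dvoretzky_covered
    by (intro exI[of _ dens] exI[of _ len]) (simp add: min_level_dens min_set_dens)
qed

end
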